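(* For an integer $n \geq 5$ and path position $P_n$ in the Mutual Failures Variant, the atomic weight of $P_n$ is $\left\lceil\frac{n}{4}\right\rceil-1$.
   Context: The Mutual Failures Variant of the Mixed Deletion Game is a partisan combinatorial game played on a finite simple undirected graph by two players, Left and Right, who alternate turns. On her turn Left deletes one vertex together with all its incident edges; on his turn Right deletes one edge. A deletion that would create an isolated vertex ends the game and the player who made it loses (so such deletions are effectively unavailable). In addition, the Mutual Failures Variant imposes the condition that in any graph position Right has no available move if and only if Left has no available move; hence every position is all-small. $P_n$ denotes the game position on the path graph with $n$ vertices. $\bigstar$ denotes far star (a sufficiently large nim heap), $\uparrow=\{0\mid\ast\}$, $\downarrow=\{\ast\mid 0\}$. Two positions $G,H$ are far star equivalent if ${\downarrow}{\bigstar}<G-H<{\uparrow}{\bigstar}$. The atomic weight $\text{AW}(G)$ of $G$ is the integer $n$ such that $G$ is far star equivalent to $n\cdot\uparrow$. *)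

theory Defs
  imports Complex_Main "HOL-Library.FSet"
begin

section \<open>Short partisan games\<close>

text \<open>
  Elements of this type are game forms, so \<open>=\<close> on them is identity of forms. Equality of
  game values is the equivalence induced by the preorder \<open>\<le>\<close> defined below.
\<close>

datatype game = Game (left_opts: "game fset") (right_opts: "game fset")

lemma size_option [simp]:
  "x |\<in>| left_opts G \<Longrightarrow> size x < size G"
  "x |\<in>| right_opts G \<Longrightarrow> size x < size G"
proof -
  have *: "size x < Suc (size_fset size X)" if "x |\<in>| X" for X :: "game fset"
    using that member_le_sum[of x "fset X" "\<lambda>x. Suc (size x)"]
    by (auto simp: size_fset_simps)
  show "x |\<in>| left_opts G \<Longrightarrow> size x < size G"
    using *[of "left_opts G"] by (cases G) auto
  show "x |\<in>| right_opts G \<Longrightarrow> size x < size G"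
    using *[of "right_opts G"] by (cases G) auto
qed

instantiation game :: "{zero, plus, uminus, minus, ord}"
begin

definition zero_game :: game where
  "0 = Game {||} {||}"

text \<open>Disjunctive sum.\<close>

function plus_game :: "game \<Rightarrow> game \<Rightarrow> game" where
  "G + H = Game
     ((\<lambda>x. x + H) |`| left_opts G |\<union>| (\<lambda>y. G + y) |`| left_opts H)
     ((\<lambda>x. x + H) |`| right_opts G |\<union>| (\<lambda>y. G + y) |`| right_opts H)"
  by pat_completeness auto
termination
  by (relation "measure (\<lambda>(G, H). size G + size H)") auto

primrec uminus_game :: "game \<Rightarrow> game" where
  "- (Game L R) = Game (uminus |`| R) (uminus |`| L)"

definition minus_game :: "game \<Rightarrow> game \<Rightarrow> game" where
  "G - H = G + (- H)" for G H :: game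

function less_eq_game :: "game \<Rightarrow> game \<Rightarrow> bool" where
  "G \<le> H \<longleftrightarrow>
     (\<forall>x |\<in>| left_opts G. \<not> H \<le> x) \<and> (\<forall>y |\<in>| right_opts H. \<not> y \<le> G)"
  by pat_completeness auto
termination
  by (relation "measure (\<lambda>(G, H). size G + size H)") auto

definition less_game :: "game \<Rightarrow> game \<Rightarrow> bool" where
  "G < H \<longleftrightarrow> G \<le> H \<and> \<not> H \<le> G" for G H :: game

instance ..

end

declare plus_game.simps [simp del] less_eq_game.simps [simp del]

function nimber :: "nat \<Rightarrow> game" where
  "nimber n = Game (nimber |`| fset_of_list [0..<n]) (nimber |`| fset_of_list [0..<n])"
  by pat_completeness auto
termination
  by (relation "measure id") (auto simp: fset_of_list_elem)

declare nimber.simps [simp del]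

abbreviation star :: game where
  "star \<equiv> nimber 1"

definition up :: game where
  "up = Game {|0|} {|star|}"

definition down :: game where
  "down = Game {|star|} {|0|}"

text \<open>The integer multiple \<open>k \<cdot> \<up>\<close>; for negative \<open>k\<close> it is a sum of copies of \<open>\<down>\<close>.\<close>

definition up_multiple :: "int \<Rightarrow> game" where
  "up_multiple k =
     (if 0 \<le> k then ((+) up ^^ nat k) 0 else ((+) down ^^ nat (- k)) 0)"

text \<open>
  Far star stands for a nim heap that is sufficiently large for the games under comparison, so an
  inequality involving it means that the inequality holds for all sufficiently large nim heaps.
\<close>

definition far_star_equiv :: "game \<Rightarrow> game \<Rightarrow> bool" where
  "far_star_equiv G H \<longleftrightarrow>
     (\<exists>N. \<forall>n\<ge>N. down + nimber n < G - H \<and> G - H < up + nimber n)"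

definition atomic_weight :: "game \<Rightarrow> int" where
  "atomic_weight G = (THE k. far_star_equiv G (up_multiple k))"


section \<open>Finite graphs\<close>

datatype 'a graph = Graph (verts: "'a fset") (edges: "'a fset fset")

definition simple_graph :: "'a graph \<Rightarrow> bool" where
  "simple_graph G \<longleftrightarrow> (\<forall>e |\<in>| edges G. e |\<subseteq>| verts G \<and> fcard e = 2)"

definition delete_vertex :: "'a graph \<Rightarrow> 'a \<Rightarrow> 'a graph" where
  "delete_vertex G v = Graph (verts G |-| {|v|}) (ffilter (\<lambda>e. v |\<notin>| e) (edges G))"

definition delete_edge :: "'a graph \<Rightarrow> 'a fset \<Rightarrow> 'a graph" where
  "delete_edge G e = Graph (verts G) (edges G |-| {|e|})"

definition isolated :: "'a graph \<Rightarrow> 'a \<Rightarrow> bool" where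
  "isolated G v \<longleftrightarrow> v |\<in>| verts G \<and> (\<forall>e |\<in>| edges G. v |\<notin>| e)"

definition connected_in :: "'a graph \<Rightarrow> 'a \<Rightarrow> 'a \<Rightarrow> bool" where
  "connected_in G = (\<lambda>u v. {|u, v|} |\<in>| edges G)\<^sup>*\<^sup>*"

definition path_graph :: "nat \<Rightarrow> nat graph" where
  "path_graph n =
     Graph (fset_of_list [0..<n]) ((\<lambda>i. {|i, Suc i|}) |`| fset_of_list [0..<n - 1])"

lemma simple_graph_path_graph: "simple_graph (path_graph n)"
  by (auto simp: simple_graph_def path_graph_def fset_of_list_elem fcard_finsert_if)

lemma simple_graph_delete:
  assumes "simple_graph G"
  shows "simple_graph (delete_vertex G v)" "simple_graph (delete_edge G e)"
  using assms by (auto simp: simple_graph_def delete_vertex_def delete_edge_def)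


section \<open>The Mutual Failures Variant of the Mixed Deletion Game\<close>

definition creates_isolated :: "'a graph \<Rightarrow> 'a graph \<Rightarrow> bool" where
  "creates_isolated G H \<longleftrightarrow> (\<exists>v. isolated H v \<and> \<not> isolated G v)"

definition safe_vertex :: "'a graph \<Rightarrow> 'a \<Rightarrow> bool" where
  "safe_vertex G v \<longleftrightarrow> v |\<in>| verts G \<and> \<not> creates_isolated G (delete_vertex G v)"

definition safe_edge :: "'a graph \<Rightarrow> 'a fset \<Rightarrow> bool" where
  "safe_edge G e \<longleftrightarrow> e |\<in>| edges G \<and> \<not> creates_isolated G (delete_edge G e)"

text \<open>
  A deletion that creates an isolated vertex loses at once, so under normal play it is modelled as
  not being available. The mutual failures condition: as soon as one of the players has no safe
  deletion in a component, that component is dead for the other player as well. The condition is imposed on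
  each connected component, so that a disconnected position is the disjunctive sum of its
  components. The predicate below says that the component of \<open>v\<close> is not dead.
\<close>

definition live :: "'a graph \<Rightarrow> 'a \<Rightarrow> bool" where
  "live G v \<longleftrightarrow>
     (\<exists>u. connected_in G v u \<and> safe_vertex G u) \<and>
     (\<exists>e. (\<exists>u |\<in>| e. connected_in G v u) \<and> safe_edge G e)"

definition left_moves :: "'a graph \<Rightarrow> 'a fset" where
  "left_moves G = ffilter (\<lambda>v. safe_vertex G v \<and> live G v) (verts G)"

definition right_moves :: "'a graph \<Rightarrow> 'a fset fset" where
  "right_moves G = ffilter (\<lambda>e. safe_edge G e \<and> (\<exists>v |\<in>| e. live G v)) (edges G)"

lemma mutual_failures:
  "left_moves G = {||} \<longleftrightarrow> right_moves G = {||}"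
proof -
  have trans: "connected_in G u w" if "connected_in G u v" "connected_in G v w" for u v w
    using that by (auto simp: connected_in_def)
  have "symp (\<lambda>u v. {|u, v|} |\<in>| edges G)"
    by (auto simp: symp_def finsert_commute)
  then have sym: "connected_in G v u" if "connected_in G u v" for u v
    using that unfolding connected_in_def by (metis symp_rtranclp sympD)
  have live_iff: "live G u \<longleftrightarrow> live G v" if "connected_in G u v" for u v
    using that trans sym unfolding live_def by meson
  have "(\<exists>v. v |\<in>| left_moves G) \<longleftrightarrow> (\<exists>v. live G v)"
    using live_iff by (auto simp: left_moves_def live_def safe_vertex_def) blast+
  moreover have "(\<exists>e. e |\<in>| right_moves G) \<longleftrightarrow> (\<exists>v. live G v)"
    using live_iff by (auto simp: right_moves_def live_def safe_edge_def) blast+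
  ultimately show ?thesis by blast
qed

function position :: "'a graph \<Rightarrow> game" where
  "position G = Game
     ((\<lambda>v. position (delete_vertex G v)) |`| left_moves G)
     ((\<lambda>e. position (delete_edge G e)) |`| right_moves G)"
  by pat_completeness auto
termination
proof (relation "measure (\<lambda>G. fcard (verts G) + fcard (edges G))", goal_cases)
  case (2 G v)
  then have "v |\<in>| verts G" by (auto simp: left_moves_def)
  then have "fcard (verts G |-| {|v|}) < fcard (verts G)"
    by (intro pfsubset_fcard_mono) auto
  moreover have "fcard (ffilter (\<lambda>e. v |\<notin>| e) (edges G)) \<le> fcard (edges G)"
    by (intro fcard_mono) auto
  ultimately show ?case by (auto simp: delete_vertex_def)
next
  case (3 G e)
  then have "e |\<in>| edges G" by (auto simp: right_moves_def)
  then have "fcard (edges G |-| {|e|}) < fcard (edges G)"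
    by (intro pfsubset_fcard_mono) auto
  then show ?case by (auto simp: delete_edge_def)
qed simp

declare position.simps [simp del]

abbreviation path_position :: "nat \<Rightarrow> game" where
  "path_position n \<equiv> position (path_graph n)"

end

theory Submission
  imports Defs "HOL-Library.Multiset"
begin

text \<open>
  In the Mutual Failures Variant a path \<open>P\<^sub>n\<close> with \<open>n \<ge> 4\<close> moves to \<open>P\<^sub>a + P\<^sub>b\<close> with
  \<open>a + b = n - 1\<close> and \<open>a, b \<noteq> 1\<close> (Left) or \<open>a + b = n\<close> and \<open>a, b \<ge> 2\<close> (Right), and
  shorter paths are zero. Give \<open>P\<^sub>n\<close> the weight \<open>(n - 1) div 4\<close>, which is
  \<open>\<lceil>n / 4\<rceil> - 1\<close>. Left's moves never raise the total weight of a sum of paths; Right's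
  moves lower it by at most one, and Right can lower it by exactly one while it is positive.

  Consider a sum of paths of total weight \<open>w\<close>, plus \<open>v\<close> copies of \<open>\<down>\<close>, plus a nim heap of
  size \<open>m\<close>. If \<open>w - v \<ge> 1\<close> then Left wins moving first, and she also wins moving second if
  \<open>w - v \<ge> 2\<close> or \<open>m \<ge> 2\<close>; dually for Right and negative \<open>w - v\<close>. In particular every
  nim heap of size at least two is already far star here. Left's main resource is the move from
  \<open>\<down>\<close> to \<open>\<ast>\<close>, which gains one unit; as \<open>\<ast>\<close> is the form of \<open>P\<^sub>4\<close>, this move
  stays within the family. When no \<open>\<down>\<close> is left, she can afford to lose one unit or to wait,
  except for a few sums of weight at most two, which are settled by hand.
\<close>

section \<open>The order and the group structure of games\<close>

lemma left_opts_plus: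
  "left_opts (G + H) = (\<lambda>x. x + H) |`| left_opts G |\<union>| (\<lambda>y. G + y) |`| left_opts H"
  by (subst plus_game.simps) simp

lemma right_opts_plus:
  "right_opts (G + H) = (\<lambda>x. x + H) |`| right_opts G |\<union>| (\<lambda>y. G + y) |`| right_opts H"
  by (subst plus_game.simps) simp

lemma left_opts_zero [simp]: "left_opts 0 = {||}"
  and right_opts_zero [simp]: "right_opts 0 = {||}"
  by (simp_all add: zero_game_def)

lemma left_opts_uminus [simp]: "left_opts (- G) = uminus |`| right_opts G"
  and right_opts_uminus [simp]: "right_opts (- G) = uminus |`| left_opts G"
  by (cases G; simp)+

lemma left_opts_nimber [simp]: "left_opts (nimber n) = nimber |`| fset_of_list [0..<n]"
  and right_opts_nimber [simp]: "right_opts (nimber n) = nimber |`| fset_of_list [0..<n]"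
  by (subst nimber.simps, simp)+

lemma nimber_0 [simp]: "nimber 0 = 0"
  by (simp add: nimber.simps zero_game_def)

lemma star_def: "star = Game {|0|} {|0|}"
  by (simp add: nimber.simps zero_game_def)

text \<open>Options form sets, so these laws hold as identities of forms and not only of values.
  Sums can therefore be rearranged freely by \<open>ac_simps\<close>.\<close>

instance game :: comm_monoid_add
proof
  fix a b c :: game
  show "a + b + c = a + (b + c)"
  proof (induction "size a + size b + size c" arbitrary: a b c rule: less_induct)
    case less
    have "left_opts (a + b + c) = left_opts (a + (b + c))"
      unfolding left_opts_plus
      by (auto simp: fimage_funion fset.map_comp o_def funion_assoc less intro!: arg_cong2[where f="(|\<union>|)"] fset.map_cong)
    moreover have "right_opts (a + b + c) = right_opts (a + (b + c))"
      unfolding right_opts_plus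
      by (auto simp: fimage_funion fset.map_comp o_def funion_assoc less intro!: arg_cong2[where f="(|\<union>|)"] fset.map_cong)
    ultimately show ?case by (rule game.expand[OF conjI])
  qed
  show "a + b = b + a"
  proof (induction "size a + size b" arbitrary: a b rule: less_induct)
    case less
    have "left_opts (a + b) = left_opts (b + a)"
      unfolding left_opts_plus
      by (subst funion_commute) (auto simp: less intro!: arg_cong2[where f="(|\<union>|)"] fset.map_cong)
    moreover have "right_opts (a + b) = right_opts (b + a)"
      unfolding right_opts_plus
      by (subst funion_commute) (auto simp: less intro!: arg_cong2[where f="(|\<union>|)"] fset.map_cong)
    ultimately show ?case by (rule game.expand[OF conjI])
  qed
  show "0 + a = a"
  proof (induction a)
    case (Game L R)
    have "left_opts (0 + Game L R) = L" "right_opts (0 + Game L R) = R"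
      using fset.map_cong0[of L "(+) 0" id] fset.map_cong0[of R "(+) 0" id] Game
      by (simp_all add: left_opts_plus right_opts_plus fset.map_id)
    then show ?case by (intro game.expand) simp
  qed
qed

text \<open>No more than a preorder, since different forms may have the same value. For
  transitivity, a left option \<open>x\<close> of \<open>a\<close> with \<open>c \<le> x\<close>
  would give \<open>b \<le> x\<close> by induction on the smaller triple \<open>b\<close>,
  \<open>c\<close>, \<open>x\<close>, against \<open>a \<le> b\<close>; right options of
  \<open>c\<close> are dual.\<close>

instance game :: preorder
proof
  fix a b c :: game
  show "a < b \<longleftrightarrow> a \<le> b \<and> \<not> b \<le> a" by (simp add: less_game_def)
  show "a \<le> a"
  proof (induction "size a" arbitrary: a rule: less_induct)
    case less
    then show ?case
      by (subst less_eq_game.simps) (metis less_eq_game.simps size_option)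
  qed
  show "a \<le> b \<Longrightarrow> b \<le> c \<Longrightarrow> a \<le> c"
  proof (induction "size a + size b + size c" arbitrary: a b c rule: less_induct)
    case less
    show ?case
    proof (subst less_eq_game.simps, intro conjI fBallI notI)
      fix x assume "x |\<in>| left_opts a" "c \<le> x"
      then show False
        using less(1)[of b c x] less(2,3) less_eq_game.simps[of a b] by fastforce
    next
      fix y assume "y |\<in>| right_opts c" "y \<le> a"
      then show False
        using less(1)[of y a b] less(2,3) less_eq_game.simps[of b c] by fastforce
    qed
  qed
qed

text \<open>With \<open>H = 0\<close> this is how strategies enter: \<open>0 \<le> G\<close> says
  that Left wins moving second, \<open>\<not> G \<le> 0\<close> that she wins moving first, and an
  option \<open>x\<close> with \<open>0 \<le> x\<close> is her winning first move. The next rule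
  does the same for Right.\<close>

lemma not_le_left_opt: "x |\<in>| left_opts G \<Longrightarrow> H \<le> x \<Longrightarrow> \<not> G \<le> H" for G H :: game
  by (subst less_eq_game.simps) auto

lemma not_le_right_opt: "y |\<in>| right_opts H \<Longrightarrow> y \<le> G \<Longrightarrow> \<not> G \<le> H" for G H :: game
  by (subst less_eq_game.simps) auto

lemma le_zero_iff: "G \<le> 0 \<longleftrightarrow> (\<forall>x |\<in>| left_opts G. \<not> 0 \<le> x)" for G :: game
  by (subst less_eq_game.simps) simp

lemma zero_le_iff: "0 \<le> G \<longleftrightarrow> (\<forall>y |\<in>| right_opts G. \<not> y \<le> 0)" for G :: game
  by (subst less_eq_game.simps) simp

text \<open>Monotonicity at \<open>G\<close>, \<open>H\<close>, \<open>K\<close> uses cancellation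
  at options of \<open>G\<close> and \<open>H\<close>, and cancellation uses monotonicity there, so
  one induction has to prove both.\<close>

lemma add_le_cancel_right_game [simp]: "G + K \<le> H + K \<longleftrightarrow> G \<le> H" for G H K :: game
proof (induction "size G + size H + size K" arbitrary: G H K rule: less_induct)
  case less
  show ?case
  proof
    assume le: "G \<le> H"
    show "G + K \<le> H + K"
    proof (subst less_eq_game.simps, intro conjI fBallI notI)
      fix z assume "z |\<in>| left_opts (G + K)" and z: "H + K \<le> z"
      then consider x where "x |\<in>| left_opts G" "z = x + K"
        | k where "k |\<in>| left_opts K" "z = G + k"
        by (auto simp: left_opts_plus)
      then show False
      proof cases
        case 1
        then have "H \<le> x" using z less[of H x K] by simp
        with 1 le show False using not_le_left_opt by blast
      next
        case 2
        then have "G + k \<le> H + k" using le less[of G H k] by simp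
        moreover have "H + k |\<in>| left_opts (H + K)" using 2 by (auto simp: left_opts_plus)
        ultimately show False using z 2 not_le_left_opt by blast
      qed
    next
      fix z assume "z |\<in>| right_opts (H + K)" and z: "z \<le> G + K"
      then consider x where "x |\<in>| right_opts H" "z = x + K"
        | k where "k |\<in>| right_opts K" "z = H + k"
        by (auto simp: right_opts_plus)
      then show False
      proof cases
        case 1
        then have "x \<le> G" using z less[of x G K] by simp
        with 1 le show False using not_le_right_opt by blast
      next
        case 2
        then have "G + k \<le> H + k" using le less[of G H k] by simp
        moreover have "G + k |\<in>| right_opts (G + K)" using 2 by (auto simp: right_opts_plus)
        ultimately show False using z 2 not_le_right_opt by blast
      qed
    qed
  next
    assume le: "G + K \<le> H + K"
    show "G \<le> H"
    proof (subst less_eq_game.simps, intro conjI fBallI notI)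
      fix x assume x: "x |\<in>| left_opts G" "H \<le> x"
      then have "H + K \<le> x + K" using less[of H x K] by simp
      moreover have "x + K |\<in>| left_opts (G + K)" using x by (auto simp: left_opts_plus)
      ultimately show False using le not_le_left_opt by blast
    next
      fix x assume x: "x |\<in>| right_opts H" "x \<le> G"
      then have "x + K \<le> G + K" using less[of x G K] by simp
      moreover have "x + K |\<in>| right_opts (H + K)" using x by (auto simp: right_opts_plus)
      ultimately show False using le not_le_right_opt by blast
    qed
  qed
qed

lemma add_le_cancel_left_game [simp]: "K + G \<le> K + H \<longleftrightarrow> G \<le> H" for G H K :: game
  by (simp add: add.commute[of K])

lemma add_mono_game: "G \<le> H \<Longrightarrow> K \<le> L \<Longrightarrow> G + K \<le> H + L" for G H K L :: game
  using order_trans[of "G + K" "H + K" "H + L"] by simp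

lemma uminus_add_game [simp]: "- (G + H) = - G + - H" for G H :: game
proof (induction "size G + size H" arbitrary: G H rule: less_induct)
  case less
  have "left_opts (- (G + H)) = left_opts (- G + - H)"
    by (auto simp: left_opts_plus right_opts_plus fimage_funion fset.map_comp o_def less
        intro!: arg_cong2[where f="(|\<union>|)"] fset.map_cong)
  moreover have "right_opts (- (G + H)) = right_opts (- G + - H)"
    by (auto simp: left_opts_plus right_opts_plus fimage_funion fset.map_comp o_def less
        intro!: arg_cong2[where f="(|\<union>|)"] fset.map_cong)
  ultimately show ?case by (rule game.expand[OF conjI])
qed

lemma uminus_zero_game [simp]: "- 0 = (0 :: game)"
  by (simp add: zero_game_def)

text \<open>The second player copies: a move in one summand is answered by the mirrored move in the
  other, which leaves \<open>x + - x\<close> for a smaller \<open>x\<close>.\<close>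

lemma add_uminus_le_zero [simp]: "G + - G \<le> 0"
  and zero_le_add_uminus [simp]: "0 \<le> G + - G" for G :: game
proof (induction "size G" arbitrary: G rule: less_induct)
  case less
  {
    case 1
    show ?case unfolding le_zero_iff
    proof
      fix z assume "z |\<in>| left_opts (G + - G)"
      then consider x where "x |\<in>| left_opts G" "z = x + - G"
        | x where "x |\<in>| right_opts G" "z = G + - x"
        by (auto simp: left_opts_plus)
      then show "\<not> 0 \<le> z"
      proof cases
        case 1
        then have "x + - x |\<in>| right_opts z" by (auto simp: right_opts_plus)
        with 1 less show ?thesis using not_le_right_opt size_option(1) by metis
      next
        case 2
        then have "x + - x |\<in>| right_opts z" by (auto simp: right_opts_plus)
        with 2 less show ?thesis using not_le_right_opt size_option(2) by metis
      qed
    qed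
  next
    case 2
    show ?case unfolding zero_le_iff
    proof
      fix z assume "z |\<in>| right_opts (G + - G)"
      then consider x where "x |\<in>| right_opts G" "z = x + - G"
        | x where "x |\<in>| left_opts G" "z = G + - x"
        by (auto simp: right_opts_plus)
      then show "\<not> z \<le> 0"
      proof cases
        case 1
        then have "x + - x |\<in>| left_opts z" by (auto simp: left_opts_plus)
        with 1 less show ?thesis using not_le_left_opt size_option(2) by metis
      next
        case 2
        then have "x + - x |\<in>| left_opts z" by (auto simp: left_opts_plus)
        with 2 less show ?thesis using not_le_left_opt size_option(1) by metis
      qed
    qed
  }
qed

lemma uminus_nimber [simp]: "- nimber n = nimber n"
proof (induction n rule: less_induct)
  case (less n)
  then have "uminus |`| nimber |`| fset_of_list [0..<n] = nimber |`| fset_of_list [0..<n]"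
    by (auto simp: fset.map_comp fset_of_list_elem intro!: fset.map_cong)
  then show ?case by (intro game.expand) simp
qed

lemma uminus_up [simp]: "- up = down" and uminus_down [simp]: "- down = up"
  by (simp_all add: up_def down_def)

lemma nimber_add_self: "nimber n + nimber n \<le> 0" "0 \<le> nimber n + nimber n"
  using add_uminus_le_zero[of "nimber n"] zero_le_add_uminus[of "nimber n"] by simp_all

lemma up_add_down: "up + down \<le> 0" "0 \<le> up + down"
  using add_uminus_le_zero[of up] zero_le_add_uminus[of up] by simp_all

lemma uminus_le_uminus_game: "- H \<le> - G \<longleftrightarrow> G \<le> H" for G H :: game
proof (induction "size G + size H" arbitrary: G H rule: less_induct)
  case less
  then show ?case by (subst (1 2) less_eq_game.simps) auto
qed

section \<open>Positions on disjoint unions and on paths\<close>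

definition graph_union :: "'a graph \<Rightarrow> 'a graph \<Rightarrow> 'a graph" where
  "graph_union G H = Graph (verts G |\<union>| verts H) (edges G |\<union>| edges H)"

lemma graph_union_sel [simp]:
  "verts (graph_union G H) = verts G |\<union>| verts H"
  "edges (graph_union G H) = edges G |\<union>| edges H"
  by (simp_all add: graph_union_def)

lemma graph_union_commute: "graph_union G H = graph_union H G"
  by (simp add: graph_union_def funion_commute)

lemma delete_sel [simp]:
  "verts (delete_vertex G v) = verts G |-| {|v|}"
  "edges (delete_vertex G v) = ffilter (\<lambda>e. v |\<notin>| e) (edges G)"
  "verts (delete_edge G e) = verts G"
  "edges (delete_edge G e) = edges G |-| {|e|}"
  by (simp_all add: delete_vertex_def delete_edge_def)

text \<open>Simplicity is included because it keeps every edge nonempty and inside its vertex set;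
  graphs with disjoint vertex sets then share no edge either.\<close>

definition disjoint_graphs :: "'a graph \<Rightarrow> 'a graph \<Rightarrow> bool" where
  "disjoint_graphs G H \<longleftrightarrow> simple_graph G \<and> simple_graph H \<and> verts G |\<inter>| verts H = {||}"

lemma disjoint_graphs_commute: "disjoint_graphs G H \<longleftrightarrow> disjoint_graphs H G"
  by (auto simp: disjoint_graphs_def)

lemma simple_graph_edge_vert: "simple_graph G \<Longrightarrow> e |\<in>| edges G \<Longrightarrow> v |\<in>| e \<Longrightarrow> v |\<in>| verts G"
  by (auto simp: simple_graph_def)

lemma simple_graph_edge_nonempty: "simple_graph G \<Longrightarrow> e |\<in>| edges G \<Longrightarrow> \<exists>v. v |\<in>| e"
  by (auto simp: simple_graph_def) (metis all_not_fin_conv fcard_fempty zero_neq_numeral)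

lemma disjoint_graphsD:
  assumes "disjoint_graphs G H"
  shows "v |\<in>| verts G \<Longrightarrow> v |\<notin>| verts H"
    "e |\<in>| edges G \<Longrightarrow> v |\<in>| e \<Longrightarrow> v |\<in>| verts G"
    "e |\<in>| edges H \<Longrightarrow> v |\<in>| e \<Longrightarrow> v |\<in>| verts H"
    "e |\<in>| edges G \<Longrightarrow> e |\<notin>| edges H"
proof -
  have G: "simple_graph G" and H: "simple_graph H" and disj: "verts G |\<inter>| verts H = {||}"
    using assms by (simp_all add: disjoint_graphs_def)
  show v: "v |\<in>| verts G \<Longrightarrow> v |\<notin>| verts H" for v using disj by blast
  show "e |\<in>| edges G \<Longrightarrow> v |\<in>| e \<Longrightarrow> v |\<in>| verts G"
    "e |\<in>| edges H \<Longrightarrow> v |\<in>| e \<Longrightarrow> v |\<in>| verts H"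
    using simple_graph_edge_vert[OF G] simple_graph_edge_vert[OF H] by simp_all
  show "e |\<notin>| edges H" if "e |\<in>| edges G"
  proof
    assume e: "e |\<in>| edges H"
    from simple_graph_edge_nonempty[OF G that] obtain u where "u |\<in>| e" ..
    then show False
      using that e v simple_graph_edge_vert[OF G] simple_graph_edge_vert[OF H] by metis
  qed
qed

lemma disjoint_graphs_delete:
  assumes "disjoint_graphs G H"
  shows "disjoint_graphs (delete_vertex G v) H" "disjoint_graphs (delete_edge G e) H"
  using assms simple_graph_delete unfolding disjoint_graphs_def by fastforce+

lemma delete_vertex_graph_union:
  assumes "disjoint_graphs G H" "v |\<in>| verts G"
  shows "delete_vertex (graph_union G H) v = graph_union (delete_vertex G v) H"
proof -
  have "v |\<notin>| verts H" "e |\<in>| edges H \<Longrightarrow> v |\<notin>| e" for e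
    using disjoint_graphsD(1,3)[OF assms(1)] assms(2) by blast+
  then show ?thesis by (intro graph.expand) auto
qed

lemma delete_edge_graph_union:
  assumes "disjoint_graphs G H" "e |\<in>| edges G"
  shows "delete_edge (graph_union G H) e = graph_union (delete_edge G e) H"
  using assms(2) by (intro graph.expand) (auto dest: disjoint_graphsD[OF assms(1)])

lemma isolated_graph_union:
  assumes "disjoint_graphs G H"
  shows "isolated (graph_union G H) v \<longleftrightarrow> isolated G v \<or> isolated H v"
  unfolding isolated_def by (auto dest: disjoint_graphsD[OF assms])

text \<open>An isolated vertex of \<open>H\<close> is isolated before and after the change from
  \<open>G\<close> to \<open>G'\<close>, so it never counts as created.\<close>

lemma creates_isolated_graph_union:
  assumes "disjoint_graphs G H" "disjoint_graphs G' H" "verts G' |\<subseteq>| verts G"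
  shows "creates_isolated (graph_union G H) (graph_union G' H) \<longleftrightarrow> creates_isolated G G'"
  using disjoint_graphsD[OF assms(1)] assms(3)
  unfolding creates_isolated_def isolated_graph_union[OF assms(1)] isolated_graph_union[OF assms(2)]
  by (auto simp: isolated_def)

lemma safe_vertex_graph_union:
  assumes "disjoint_graphs G H" "v |\<in>| verts G"
  shows "safe_vertex (graph_union G H) v \<longleftrightarrow> safe_vertex G v"
  using assms
  by (simp add: safe_vertex_def delete_vertex_graph_union disjoint_graphs_delete
      creates_isolated_graph_union[OF assms(1)] fsubset_iff)

lemma safe_edge_graph_union:
  assumes "disjoint_graphs G H" "e |\<in>| edges G"
  shows "safe_edge (graph_union G H) e \<longleftrightarrow> safe_edge G e"
  using assms
  by (simp add: safe_edge_def delete_edge_graph_union creates_isolated_graph_union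
      disjoint_graphs_delete fsubset_iff)

lemma connected_in_verts:
  assumes "simple_graph G" "connected_in G v u" "v |\<in>| verts G"
  shows "u |\<in>| verts G"
  using assms(2,3) unfolding connected_in_def
  by (induction rule: rtranclp_induct) (auto intro: simple_graph_edge_vert[OF assms(1)])

lemma connected_in_graph_union:
  assumes "disjoint_graphs G H" "v |\<in>| verts G"
  shows "connected_in (graph_union G H) v u \<longleftrightarrow> connected_in G v u"
proof
  assume "connected_in G v u"
  then show "connected_in (graph_union G H) v u"
    unfolding connected_in_def by (rule rtranclp_mono[THEN predicate2D, rotated]) auto
next
  assume "connected_in (graph_union G H) v u"
  then show "connected_in G v u"
    unfolding connected_in_def
  proof (induction rule: rtranclp_induct)
    case (step y z)
    then have "y |\<in>| verts G"
      using connected_in_verts[of G v y] assms by (auto simp: connected_in_def disjoint_graphs_def)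
    then have "y |\<notin>| verts H" using disjoint_graphsD(1)[OF assms(1)] by blast
    then have "{|y, z|} |\<notin>| edges H" using disjoint_graphsD(3)[OF assms(1), of "{|y, z|}" y] by blast
    with step(2) have "{|y, z|} |\<in>| edges G" by simp
    with step.IH show ?case by (rule rtranclp.rtrancl_into_rtrancl)
  qed simp
qed

text \<open>Liveness looks only at the component of \<open>v\<close>, which lies inside
  \<open>G\<close>. This is where imposing mutual failures on each component pays off: play in
  \<open>H\<close> cannot kill or revive \<open>G\<close>.\<close>

lemma live_graph_union:
  assumes "disjoint_graphs G H" "v |\<in>| verts G"
  shows "live (graph_union G H) v \<longleftrightarrow> live G v"
proof -
  have G: "simple_graph G" using assms by (simp add: disjoint_graphs_def)
  have vert: "u |\<in>| verts G" if "connected_in G v u" for u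
    using connected_in_verts[OF G that assms(2)] .
  have edge: "e |\<in>| edges G" if "u |\<in>| e" "connected_in G v u" "safe_edge (graph_union G H) e" for u e
    using that vert by (auto simp: safe_edge_def dest: disjoint_graphsD[OF assms(1)])
  show ?thesis
    unfolding live_def connected_in_graph_union[OF assms]
    using vert edge safe_vertex_graph_union[OF assms(1)] safe_edge_graph_union[OF assms(1)]
    by (smt (verit) safe_edge_def)
qed

lemma left_moves_graph_union:
  assumes "disjoint_graphs G H"
  shows "left_moves (graph_union G H) = left_moves G |\<union>| left_moves H"
proof -
  have HG: "disjoint_graphs H G" using assms by (simp add: disjoint_graphs_commute)
  show ?thesis
    using safe_vertex_graph_union[OF assms] live_graph_union[OF assms]
      safe_vertex_graph_union[OF HG] live_graph_union[OF HG]
    unfolding left_moves_def graph_union_commute[of H G] by auto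
qed

lemma right_moves_graph_union:
  assumes "disjoint_graphs G H"
  shows "right_moves (graph_union G H) = right_moves G |\<union>| right_moves H"
proof -
  have HG: "disjoint_graphs H G" using assms by (simp add: disjoint_graphs_commute)
  have 1: "e |\<in>| right_moves (graph_union G H) \<longleftrightarrow> e |\<in>| right_moves G"
    if GH: "disjoint_graphs G H" and e: "e |\<in>| edges G" for G H :: "'a graph" and e
    using e live_graph_union[OF GH] disjoint_graphsD(2)[OF GH e] safe_edge_graph_union[OF GH e]
    unfolding right_moves_def by auto
  have 2: "e |\<in>| edges G \<or> e |\<in>| edges H" if "e |\<in>| right_moves (graph_union G H)" for e
    using that by (simp add: right_moves_def)
  have 3: "e |\<in>| edges K" if "e |\<in>| right_moves K" for e and K :: "'a graph"
    using that by (simp add: right_moves_def)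
  show ?thesis
    using 1[OF assms] 1[OF HG] 2 3 unfolding graph_union_commute[of H G] by blast
qed

text \<open>The moves in the union are those in the two parts, and each leaves the other part
  unchanged. The induction runs on the sizes of the game forms, which drop when passing to
  options.\<close>

lemma position_graph_union:
  assumes "disjoint_graphs G H"
  shows "position (graph_union G H) = position G + position H"
  using assms
proof (induction "size (position G) + size (position H)" arbitrary: G H rule: less_induct)
  case less
  have HG: "disjoint_graphs H G" using less.prems by (simp add: disjoint_graphs_commute)
  have opts: "left_opts (position K) = (\<lambda>v. position (delete_vertex K v)) |`| left_moves K"
    "right_opts (position K) = (\<lambda>e. position (delete_edge K e)) |`| right_moves K" for K :: "'a graph"
    by (subst position.simps, simp)+
  have 1: "position (delete_vertex (graph_union G H) v) = position (delete_vertex G v) + position H"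
    if "v |\<in>| left_moves G" for v
    using that less by (auto simp: left_moves_def opts delete_vertex_graph_union disjoint_graphs_delete)
  have 2: "position (delete_vertex (graph_union G H) v) = position G + position (delete_vertex H v)"
    if "v |\<in>| left_moves H" for v
  proof -
    have "delete_vertex (graph_union G H) v = graph_union G (delete_vertex H v)"
      using that delete_vertex_graph_union[OF HG]
      by (auto simp: left_moves_def graph_union_commute[of G])
    then show ?thesis
      using that less disjoint_graphs_delete(1)[OF HG]
      by (auto simp: opts disjoint_graphs_commute[of G])
  qed
  have 3: "position (delete_edge (graph_union G H) v) = position (delete_edge G v) + position H"
    if "v |\<in>| right_moves G" for v
    using that less by (auto simp: right_moves_def opts delete_edge_graph_union disjoint_graphs_delete)
  have 4: "position (delete_edge (graph_union G H) v) = position G + position (delete_edge H v)"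
    if "v |\<in>| right_moves H" for v
  proof -
    have "delete_edge (graph_union G H) v = graph_union G (delete_edge H v)"
      using that delete_edge_graph_union[OF HG]
      by (auto simp: right_moves_def graph_union_commute[of G])
    then show ?thesis
      using that less disjoint_graphs_delete(2)[OF HG]
      by (auto simp: opts disjoint_graphs_commute[of G])
  qed
  show ?case
    using less.prems
    by (intro game.expand conjI;
        simp add: opts left_opts_plus right_opts_plus left_moves_graph_union right_moves_graph_union
          fimage_funion fset.map_comp o_def;
        intro arg_cong2[where f="(|\<union>|)"] fset.map_cong refl; simp add: 1 2 3 4)
qed

section \<open>Invariance of positions under relabelling of vertices\<close>

lemma map_graph_sel [simp]:
  "verts (map_graph f G) = f |`| verts G"
  "edges (map_graph f G) = (|`|) f |`| edges G"
  by (cases G; simp)+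

lemma inj_fimage: "inj f \<Longrightarrow> inj ((|`|) f)"
  by (rule injI) (metis fset.inj_map_strong injD)

context
  fixes f :: "'a \<Rightarrow> 'b"
  assumes inj: "inj f"
begin

lemma fimage_mem_iff: "f x \<in> f ` fset X \<longleftrightarrow> x |\<in>| X"
  by (simp add: inj_image_mem_iff[OF inj])

lemma fimage_fimage_mem_iff: "f |`| e \<in> (|`|) f ` fset X \<longleftrightarrow> e |\<in>| X"
  by (simp add: inj_image_mem_iff[OF inj_fimage[OF inj]])

lemma delete_vertex_map_graph: "delete_vertex (map_graph f G) (f v) = map_graph f (delete_vertex G v)"
  using inj by (intro graph.expand) (auto simp: fimage_mem_iff dest: injD)

lemma delete_edge_map_graph: "delete_edge (map_graph f G) (f |`| e) = map_graph f (delete_edge G e)"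
  using inj_fimage[OF inj] by (intro graph.expand) (auto dest: injD)

lemma isolated_map_graph: "isolated (map_graph f G) (f v) \<longleftrightarrow> isolated G v"
  unfolding isolated_def by (simp add: fimage_mem_iff)

lemma creates_isolated_map_graph:
  "creates_isolated (map_graph f G) (map_graph f H) \<longleftrightarrow> creates_isolated G H"
proof -
  have "\<exists>u. v = f u" if "isolated (map_graph f H) v" for v
    using that by (auto simp: isolated_def)
  then show ?thesis
    unfolding creates_isolated_def using isolated_map_graph by metis
qed

lemma safe_map_graph:
  "safe_vertex (map_graph f G) (f v) \<longleftrightarrow> safe_vertex G v"
  "safe_edge (map_graph f G) (f |`| e) \<longleftrightarrow> safe_edge G e"
  unfolding safe_vertex_def safe_edge_def
  by (simp_all add: delete_vertex_map_graph delete_edge_map_graph creates_isolated_map_graph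
      fimage_mem_iff fimage_fimage_mem_iff)

lemma edge_map_graph: "{|f v, f u|} |\<in>| edges (map_graph f G) \<longleftrightarrow> {|v, u|} |\<in>| edges G"
  using fimage_fimage_mem_iff[of "{|v, u|}" "edges G"] by simp

lemma connected_in_map_graph:
  "connected_in (map_graph f G) (f v) w \<longleftrightarrow> (\<exists>u. w = f u \<and> connected_in G v u)"
proof
  assume "connected_in (map_graph f G) (f v) w"
  then show "\<exists>u. w = f u \<and> connected_in G v u"
    unfolding connected_in_def
  proof (induction rule: rtranclp_induct)
    case (step y z)
    then obtain u where u: "y = f u" "(\<lambda>u v. {|u, v|} |\<in>| edges G)\<^sup>*\<^sup>* v u" by blast
    obtain e where e: "{|y, z|} = f |`| e" "e |\<in>| edges G" using step(2) by auto
    then obtain w where "z = f w" by (metis fimageE finsert_iff)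
    with u e step(2) have "{|u, w|} |\<in>| edges G" using edge_map_graph by metis
    with u(2) have "(\<lambda>u v. {|u, v|} |\<in>| edges G)\<^sup>*\<^sup>* v w" by (rule rtranclp.rtrancl_into_rtrancl)
    with \<open>z = f w\<close> show ?case by blast
  qed blast
next
  assume "\<exists>u. w = f u \<and> connected_in G v u"
  then obtain u where w: "w = f u" and u: "connected_in G v u" by blast
  from u show "connected_in (map_graph f G) (f v) w"
    unfolding connected_in_def w
  proof (induction rule: rtranclp_induct)
    case (step y z)
    then show ?case
      using edge_map_graph[of y z G] by (meson rtranclp.rtrancl_into_rtrancl)
  qed simp
qed

lemma live_map_graph: "live (map_graph f G) (f v) \<longleftrightarrow> live G v"
proof -
  have edge: "\<exists>d. e = f |`| d" if "safe_edge (map_graph f G) e" for e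
    using that by (auto simp: safe_edge_def)
  have touch: "(\<exists>u |\<in>| f |`| d. connected_in (map_graph f G) (f v) u) \<longleftrightarrow>
      (\<exists>u |\<in>| d. connected_in G v u)" for d
    unfolding connected_in_map_graph using inj by (auto dest: injD)
  have "(\<exists>u. connected_in (map_graph f G) (f v) u \<and> safe_vertex (map_graph f G) u) \<longleftrightarrow>
      (\<exists>u. connected_in G v u \<and> safe_vertex G u)"
    unfolding connected_in_map_graph by (auto simp: safe_map_graph)
  moreover have "(\<exists>e. (\<exists>u |\<in>| e. connected_in (map_graph f G) (f v) u) \<and> safe_edge (map_graph f G) e)
      \<longleftrightarrow> (\<exists>d. (\<exists>u |\<in>| f |`| d. connected_in (map_graph f G) (f v) u) \<and>
        safe_edge (map_graph f G) (f |`| d))"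
    using edge by blast
  ultimately show ?thesis
    unfolding live_def touch safe_map_graph by simp
qed

lemma moves_map_graph:
  "left_moves (map_graph f G) = f |`| left_moves G"
  "right_moves (map_graph f G) = (|`|) f |`| right_moves G"
proof -
  show "left_moves (map_graph f G) = f |`| left_moves G"
    by (auto simp: left_moves_def safe_map_graph live_map_graph)
  show "right_moves (map_graph f G) = (|`|) f |`| right_moves G"
    by (auto simp: right_moves_def safe_map_graph live_map_graph intro!: imageI) blast
qed

lemma position_map_graph: "position (map_graph f G) = position G"
proof (induction G rule: position.induct)
  case (1 G)
  show ?case
    by (subst (1 2) position.simps)
      (auto simp: moves_map_graph fset.map_comp o_def delete_vertex_map_graph delete_edge_map_graph 1
        intro!: fset.map_cong)
qed

end

section \<open>Paths and the pieces left by a deletion\<close>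

definition shift_path :: "nat \<Rightarrow> nat \<Rightarrow> nat graph" where
  "shift_path c n = map_graph ((+) c) (path_graph n)"

text \<open>The piece to the right of a deletion keeps its labels; this lets it count as an ordinary
  path.\<close>

lemma position_shift_path: "position (shift_path c n) = path_position n"
  unfolding shift_path_def by (rule position_map_graph) simp

lemma path_graph_sel:
  "v |\<in>| verts (path_graph n) \<longleftrightarrow> v < n"
  "e |\<in>| edges (path_graph n) \<longleftrightarrow> (\<exists>i. e = {|i, Suc i|} \<and> Suc i < n)"
  by (auto simp: path_graph_def fset_of_list_elem)

lemma shift_path_sel:
  "v |\<in>| verts (shift_path c n) \<longleftrightarrow> c \<le> v \<and> v < c + n"
  "e |\<in>| edges (shift_path c n) \<longleftrightarrow> (\<exists>i. e = {|i, Suc i|} \<and> c \<le> i \<and> Suc i < c + n)"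
proof -
  have "(\<exists>j<n. v = c + j) \<longleftrightarrow> c \<le> v \<and> v < c + n"
    by (metis add_less_cancel_left le_add1 le_iff_add)
  then show "v |\<in>| verts (shift_path c n) \<longleftrightarrow> c \<le> v \<and> v < c + n"
    by (auto simp: shift_path_def path_graph_def fset_of_list_elem)
  show "e |\<in>| edges (shift_path c n) \<longleftrightarrow> (\<exists>i. e = {|i, Suc i|} \<and> c \<le> i \<and> Suc i < c + n)"
  proof
    assume "e |\<in>| edges (shift_path c n)"
    then show "\<exists>i. e = {|i, Suc i|} \<and> c \<le> i \<and> Suc i < c + n"
      by (fastforce simp: shift_path_def path_graph_sel)
  next
    assume "\<exists>i. e = {|i, Suc i|} \<and> c \<le> i \<and> Suc i < c + n"
    then obtain i where i: "e = {|i, Suc i|}" "c \<le> i" "Suc i < c + n" by blast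
    then have "e = (+) c |`| {|i - c, Suc (i - c)|}" "Suc (i - c) < n" by auto
    then show "e |\<in>| edges (shift_path c n)"
      unfolding shift_path_def map_graph_sel using path_graph_sel(2) by blast
  qed
qed

lemma simple_graph_shift_path: "simple_graph (shift_path c n)"
  unfolding simple_graph_def by (auto simp: shift_path_sel fcard_finsert_if)

lemma disjoint_paths: "a \<le> c \<Longrightarrow> disjoint_graphs (path_graph a) (shift_path c b)"
  by (auto simp: disjoint_graphs_def simple_graph_path_graph simple_graph_shift_path
      path_graph_sel shift_path_sel)

lemma doubleton_Suc_eq_iff: "{|i, Suc i|} = {|j, Suc j|} \<longleftrightarrow> i = j"
proof
  assume eq: "{|i, Suc i|} = {|j, Suc j|}"
  have "i |\<in>| {|j, Suc j|}" by (simp flip: eq)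
  moreover have "j |\<in>| {|i, Suc i|}" by (simp add: eq)
  ultimately show "i = j" by auto
qed simp

lemma delete_vertex_path_graph:
  assumes "i < n"
  shows "delete_vertex (path_graph n) i = graph_union (path_graph i) (shift_path (Suc i) (n - 1 - i))"
proof (rule graph.expand, intro conjI fset_eqI)
  fix v show "v |\<in>| verts (delete_vertex (path_graph n) i) \<longleftrightarrow>
    v |\<in>| verts (graph_union (path_graph i) (shift_path (Suc i) (n - 1 - i)))"
    using assms by (auto simp: path_graph_sel shift_path_sel)
next
  fix e
  have "Suc j < n \<and> i \<noteq> j \<and> i \<noteq> Suc j \<longleftrightarrow> Suc j < i \<or> Suc i \<le> j \<and> Suc j < n" for j
    using assms by auto
  then have "(\<exists>j. e = {|j, Suc j|} \<and> Suc j < n \<and> i \<noteq> j \<and> i \<noteq> Suc j) \<longleftrightarrow>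
    (\<exists>j. e = {|j, Suc j|} \<and> Suc j < i) \<or> (\<exists>j. e = {|j, Suc j|} \<and> Suc i \<le> j \<and> Suc j < n)"
    by blast
  then show "e |\<in>| edges (delete_vertex (path_graph n) i) \<longleftrightarrow>
    e |\<in>| edges (graph_union (path_graph i) (shift_path (Suc i) (n - 1 - i)))"
    using assms by (auto simp: path_graph_sel shift_path_sel)
qed

lemma delete_edge_path_graph:
  assumes "Suc i < n"
  shows "delete_edge (path_graph n) {|i, Suc i|} =
    graph_union (path_graph (Suc i)) (shift_path (Suc i) (n - 1 - i))"
proof (rule graph.expand, intro conjI fset_eqI)
  fix v show "v |\<in>| verts (delete_edge (path_graph n) {|i, Suc i|}) \<longleftrightarrow>
    v |\<in>| verts (graph_union (path_graph (Suc i)) (shift_path (Suc i) (n - 1 - i)))"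
    using assms by (auto simp: path_graph_sel shift_path_sel)
next
  fix e
  have "Suc j < n \<and> i \<noteq> j \<longleftrightarrow> Suc j < Suc i \<or> Suc i \<le> j \<and> Suc j < n" for j
    using assms by auto
  then have split: "(\<exists>j. e = {|j, Suc j|} \<and> Suc j < n \<and> i \<noteq> j) \<longleftrightarrow>
    (\<exists>j. e = {|j, Suc j|} \<and> Suc j < Suc i) \<or> (\<exists>j. e = {|j, Suc j|} \<and> Suc i \<le> j \<and> Suc j < n)"
    by blast
  have "e |\<in>| edges (delete_edge (path_graph n) {|i, Suc i|}) \<longleftrightarrow>
    (\<exists>j. e = {|j, Suc j|} \<and> Suc j < n) \<and> e \<noteq> {|i, Suc i|}"
    by (simp add: path_graph_sel)
  also have "\<dots> \<longleftrightarrow> (\<exists>j. e = {|j, Suc j|} \<and> Suc j < n \<and> i \<noteq> j)"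
    using doubleton_Suc_eq_iff[of i] by metis
  finally show "e |\<in>| edges (delete_edge (path_graph n) {|i, Suc i|}) \<longleftrightarrow>
    e |\<in>| edges (graph_union (path_graph (Suc i)) (shift_path (Suc i) (n - 1 - i)))"
    using assms by (simp add: split path_graph_sel shift_path_sel)
qed

lemma isolated_path_graph: "isolated (path_graph n) v \<longleftrightarrow> n = 1 \<and> v = 0"
proof
  assume iso: "isolated (path_graph n) v"
  then have "v < n" by (simp add: isolated_def path_graph_sel)
  moreover have "\<not> Suc v < n"
    using iso path_graph_sel(2)[of "{|v, Suc v|}" n] by (auto simp: isolated_def)
  moreover have "v = 0"
  proof (rule ccontr)
    assume "v \<noteq> 0"
    then have "{|v - 1, v|} |\<in>| edges (path_graph n)"
      using \<open>v < n\<close> by (auto simp: path_graph_sel intro!: exI[of _ "v - 1"])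
    then show False using iso by (auto simp: isolated_def)
  qed
  ultimately show "n = 1 \<and> v = 0" by simp
qed (auto simp: isolated_def path_graph_sel)

lemma isolated_shift_path: "isolated (shift_path c n) v \<longleftrightarrow> n = 1 \<and> v = c"
proof -
  have "isolated (shift_path c n) (c + u) \<longleftrightarrow> n = 1 \<and> u = 0" for u
    unfolding shift_path_def
    using isolated_map_graph[of "(+) c"] isolated_path_graph by simp
  moreover have "c \<le> v" if "isolated (shift_path c n) v"
    using that by (simp add: isolated_def shift_path_sel)
  ultimately show ?thesis by (metis le_iff_add add_0_right)
qed

text \<open>Only a piece with a single vertex has an isolated vertex. For \<open>n = 1\<close> that
  vertex may be isolated beforehand, hence the first hypothesis.\<close>

lemma creates_isolated_path_graph:
  assumes "n \<noteq> 1" "a \<le> c"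
  shows "creates_isolated (path_graph n) (graph_union (path_graph a) (shift_path c b)) \<longleftrightarrow>
    a = 1 \<or> b = 1"
  using assms
  by (auto simp: creates_isolated_def isolated_graph_union disjoint_paths isolated_path_graph
      isolated_shift_path)

lemma safe_vertex_path_graph:
  assumes "n \<noteq> 1"
  shows "safe_vertex (path_graph n) i \<longleftrightarrow> i < n \<and> i \<noteq> 1 \<and> n - 1 - i \<noteq> 1"
  using assms
  by (auto simp: safe_vertex_def path_graph_sel delete_vertex_path_graph creates_isolated_path_graph)

lemma safe_edge_path_graph:
  "safe_edge (path_graph n) e \<longleftrightarrow> (\<exists>i. e = {|i, Suc i|} \<and> 1 \<le> i \<and> i + 3 \<le> n)"
proof -
  have "safe_edge (path_graph n) {|i, Suc i|} \<longleftrightarrow> 1 \<le> i \<and> i + 3 \<le> n" for i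
  proof (cases "Suc i < n")
    case True
    then show ?thesis
      by (auto simp: safe_edge_def path_graph_sel delete_edge_path_graph creates_isolated_path_graph)
  qed (auto simp: safe_edge_def path_graph_sel doubleton_Suc_eq_iff)
  moreover have "\<exists>i. e = {|i, Suc i|}" if "safe_edge (path_graph n) e"
    using that by (auto simp: safe_edge_def path_graph_sel)
  ultimately show ?thesis by metis
qed

lemma connected_in_path_graph:
  assumes "u < n" "v < n"
  shows "connected_in (path_graph n) u v"
proof -
  have 0: "connected_in (path_graph n) 0 v \<and> connected_in (path_graph n) v 0" if "v < n" for v
    using that
  proof (induction v)
    case (Suc v)
    then have "{|v, Suc v|} |\<in>| edges (path_graph n)" "{|Suc v, v|} |\<in>| edges (path_graph n)"
      by (auto simp: path_graph_sel finsert_commute)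
    with Suc show ?case
      unfolding connected_in_def
      by (auto intro: rtranclp.rtrancl_into_rtrancl converse_rtranclp_into_rtranclp)
  qed (simp add: connected_in_def)
  from 0[of u] 0[of v] assms show ?thesis
    unfolding connected_in_def by (meson rtranclp_trans)
qed

text \<open>Right needs two vertices on each side of the deleted edge, so at least four in all, and
  then Left can safely delete an end. On three vertices Left has a safe deletion but Right has none,
  so that path is dead.\<close>

lemma live_path_graph: "live (path_graph n) v \<longleftrightarrow> v < n \<and> 4 \<le> n"
proof
  assume live: "live (path_graph n) v"
  then obtain e u where e: "u |\<in>| e" "connected_in (path_graph n) v u" "safe_edge (path_graph n) e"
    unfolding live_def by blast
  then have "4 \<le> n" "u < n" by (auto simp: safe_edge_path_graph)
  moreover have "v < n"
    using e(2) \<open>u < n\<close> unfolding connected_in_def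
  proof (induction rule: converse_rtranclp_induct)
    case (step y z)
    then show ?case
      using simple_graph_edge_vert[OF simple_graph_path_graph, of "{|y, z|}" n y]
      by (simp add: path_graph_sel(1))
  qed
  ultimately show "v < n \<and> 4 \<le> n" by simp
next
  assume v: "v < n \<and> 4 \<le> n"
  then have "safe_vertex (path_graph n) 0" "safe_edge (path_graph n) {|1, Suc 1|}"
    by (auto simp: safe_vertex_path_graph safe_edge_path_graph)
  moreover have "connected_in (path_graph n) v 0" "connected_in (path_graph n) v 1"
    using v by (auto intro: connected_in_path_graph)
  ultimately show "live (path_graph n) v"
    unfolding live_def by blast
qed

text \<open>\<open>a = 0\<close> or \<open>b = 0\<close> is the deletion of an end vertex. The bound
  \<open>4 \<le> n\<close> comes from liveness and excludes, for instance, the move from three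
  vertices to two; for Right it follows from \<open>2 \<le> a\<close> and
  \<open>2 \<le> b\<close>.\<close>

lemma left_opts_path_position:
  "x |\<in>| left_opts (path_position n) \<longleftrightarrow>
    (\<exists>a b. n = a + b + 1 \<and> 4 \<le> n \<and> a \<noteq> 1 \<and> b \<noteq> 1 \<and> x = path_position a + path_position b)"
proof -
  have moves: "i |\<in>| left_moves (path_graph n) \<longleftrightarrow> i < n \<and> 4 \<le> n \<and> i \<noteq> 1 \<and> n - 1 - i \<noteq> 1" for i
    by (auto simp: left_moves_def live_path_graph safe_vertex_path_graph path_graph_sel)
  have del: "position (delete_vertex (path_graph n) i) = path_position i + path_position (n - 1 - i)"
    if "i < n" for i
    using that by (simp add: delete_vertex_path_graph position_graph_union disjoint_paths position_shift_path)
  have "x |\<in>| left_opts (path_position n) \<longleftrightarrow>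
    (\<exists>i. i |\<in>| left_moves (path_graph n) \<and> x = position (delete_vertex (path_graph n) i))"
    by (subst position.simps) auto
  also have "\<dots> \<longleftrightarrow> (\<exists>i<n. 4 \<le> n \<and> i \<noteq> 1 \<and> n - 1 - i \<noteq> 1 \<and> x = path_position i + path_position (n - 1 - i))"
    unfolding moves using del by metis
  also have "\<dots> \<longleftrightarrow> (\<exists>a b. n = a + b + 1 \<and> 4 \<le> n \<and> a \<noteq> 1 \<and> b \<noteq> 1 \<and> x = path_position a + path_position b)"
    (is "?l \<longleftrightarrow> ?r")
  proof
    assume ?l
    then obtain i where "i < n" "4 \<le> n" "i \<noteq> 1" "n - 1 - i \<noteq> 1"
      "x = path_position i + path_position (n - 1 - i)" by blast
    then show ?r by (intro exI[of _ i] exI[of _ "n - 1 - i"]) auto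
  next
    assume ?r
    then obtain a b where "n = a + b + 1" "4 \<le> n" "a \<noteq> 1" "b \<noteq> 1"
      "x = path_position a + path_position b" by blast
    then show ?l by (intro exI[of _ a]) auto
  qed
  finally show ?thesis .
qed

lemma right_opts_path_position:
  "x |\<in>| right_opts (path_position n) \<longleftrightarrow>
    (\<exists>a b. n = a + b \<and> 2 \<le> a \<and> 2 \<le> b \<and> x = path_position a + path_position b)"
proof -
  have moves: "e |\<in>| right_moves (path_graph n) \<longleftrightarrow> (\<exists>i. e = {|i, Suc i|} \<and> 1 \<le> i \<and> i + 3 \<le> n)" for e
    by (auto simp: right_moves_def live_path_graph safe_edge_path_graph path_graph_sel)
  have del: "position (delete_edge (path_graph n) {|i, Suc i|}) =
      path_position (Suc i) + path_position (n - 1 - i)"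
    if "Suc i < n" for i
    using that by (simp add: delete_edge_path_graph position_graph_union disjoint_paths position_shift_path)
  have "x |\<in>| right_opts (path_position n) \<longleftrightarrow>
    (\<exists>e. e |\<in>| right_moves (path_graph n) \<and> x = position (delete_edge (path_graph n) e))"
    by (subst position.simps) auto
  also have "\<dots> \<longleftrightarrow> (\<exists>i. 1 \<le> i \<and> i + 3 \<le> n \<and> x = position (delete_edge (path_graph n) {|i, Suc i|}))"
    unfolding moves by blast
  also have "\<dots> \<longleftrightarrow> (\<exists>i. 1 \<le> i \<and> i + 3 \<le> n \<and> x = path_position (Suc i) + path_position (n - 1 - i))"
    by (simp add: del cong: conj_cong)
  also have "\<dots> \<longleftrightarrow> (\<exists>a b. n = a + b \<and> 2 \<le> a \<and> 2 \<le> b \<and> x = path_position a + path_position b)"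
    (is "?l \<longleftrightarrow> ?r")
  proof
    assume ?l
    then obtain i where "1 \<le> i" "i + 3 \<le> n"
      "x = path_position (Suc i) + path_position (n - 1 - i)" by blast
    then show ?r by (intro exI[of _ "Suc i"] exI[of _ "n - 1 - i"]) auto
  next
    assume ?r
    then obtain a b where "n = a + b" "2 \<le> a" "2 \<le> b" "x = path_position a + path_position b" by blast
    then show ?l by (intro exI[of _ "a - 1"]) (auto simp: Suc_diff_le)
  qed
  finally show ?thesis .
qed

section \<open>Equality of values, and nim heaps\<close>

definition game_eq :: "game \<Rightarrow> game \<Rightarrow> bool" (infix "\<approx>" 50) where
  "G \<approx> H \<longleftrightarrow> G \<le> H \<and> H \<le> G"

lemma game_eq_refl [simp]: "G \<approx> G"
  by (simp add: game_eq_def)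

lemma game_eq_sym: "G \<approx> H \<Longrightarrow> H \<approx> G"
  by (simp add: game_eq_def)

lemma game_eq_trans [trans]: "G \<approx> H \<Longrightarrow> H \<approx> K \<Longrightarrow> G \<approx> K"
  unfolding game_eq_def by (blast intro: order_trans)

lemma game_eq_add: "G \<approx> H \<Longrightarrow> K \<approx> L \<Longrightarrow> G + K \<approx> H + L"
  unfolding game_eq_def by (blast intro: add_mono_game)

lemma game_eq_le_cong: "G \<approx> G' \<Longrightarrow> H \<approx> H' \<Longrightarrow> G \<le> H \<longleftrightarrow> G' \<le> H'"
  unfolding game_eq_def by (blast intro: order_trans)

lemma nimber_add_self_eq: "nimber m + nimber m \<approx> 0"
  by (simp add: game_eq_def nimber_add_self)

lemma left_opts_down [simp]: "left_opts down = {|star|}"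
  and right_opts_down [simp]: "right_opts down = {|0|}"
  and right_opts_up [simp]: "right_opts up = {|star|}"
  by (simp_all add: down_def up_def)

lemma fset_of_list_upt [simp]: "i |\<in>| fset_of_list [0..<n] \<longleftrightarrow> i < n"
  by (simp add: fset_of_list_elem)

lemma left_opts_plus_iff: "x |\<in>| left_opts (G + H) \<longleftrightarrow>
    (\<exists>y. y |\<in>| left_opts G \<and> x = y + H) \<or> (\<exists>y. y |\<in>| left_opts H \<and> x = G + y)"
  by (auto simp: left_opts_plus)

lemma right_opts_plus_iff: "x |\<in>| right_opts (G + H) \<longleftrightarrow>
    (\<exists>y. y |\<in>| right_opts G \<and> x = y + H) \<or> (\<exists>y. y |\<in>| right_opts H \<and> x = G + y)"
  by (auto simp: right_opts_plus)

lemma left_opts_nimber_iff: "x |\<in>| left_opts (nimber m) \<longleftrightarrow> (\<exists>j<m. x = nimber j)"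
  and right_opts_nimber_iff: "x |\<in>| right_opts (nimber m) \<longleftrightarrow> (\<exists>j<m. x = nimber j)"
  by auto

lemma not_le_zero_add_nimberI:
  "j < m \<Longrightarrow> 0 \<le> G + nimber j \<Longrightarrow> \<not> G + nimber m \<le> 0"
  by (rule not_le_left_opt[of "G + nimber j"]) (auto simp: left_opts_plus)

lemma not_zero_le_add_nimberI:
  "j < m \<Longrightarrow> G + nimber j \<le> 0 \<Longrightarrow> \<not> 0 \<le> G + nimber m"
  by (rule not_le_right_opt[of "G + nimber j"]) (auto simp: right_opts_plus)

lemma zero_le_add_nimberI:
  assumes "\<And>y. y |\<in>| right_opts G \<Longrightarrow> \<not> y + nimber m \<le> 0"
    and "\<And>j. j < m \<Longrightarrow> \<not> G + nimber j \<le> 0"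
  shows "0 \<le> G + nimber m"
  using assms by (auto simp: zero_le_iff right_opts_plus)

lemma nimber_not_le_zero: "0 < m \<Longrightarrow> \<not> nimber m \<le> 0"
  using not_le_zero_add_nimberI[of 0 m 0] by simp

lemma nimber_not_zero_le: "0 < m \<Longrightarrow> \<not> 0 \<le> nimber m"
  using not_zero_le_add_nimberI[of 0 m 0] by simp

lemma down_le_zero: "down \<le> 0"
  using nimber_not_zero_le[of 1] by (simp add: le_zero_iff)

lemma zero_le_up: "0 \<le> up"
  using uminus_le_uminus_game[of 0 down] down_le_zero by simp

text \<open>Heap sizes are paired as \<open>2 * k\<close> and \<open>2 * k + 1\<close>. If Left
  lowers one heap into a smaller pair, Right moves the other heap to the partner. If she lowers the
  odd heap to \<open>2 * j\<close>, he takes the star and leaves two equal heaps; if she takes the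
  star, he equalises the heaps.\<close>

lemma nimber_double_add_star_le: "nimber (2 * j) + nimber (Suc (2 * j)) + star \<le> 0"
proof (induction j rule: less_induct)
  case (less j)
  let ?e = "\<lambda>j. nimber (2 * j)" and ?o = "\<lambda>j. nimber (Suc (2 * j))"
  have parity: "\<exists>k<j. i = 2 * k \<or> i = Suc (2 * k)" if "i < 2 * j" for i
    by (rule exI[of _ "i div 2"]) (use that in presburger)
  have reply_fst: "\<not> 0 \<le> nimber a + nimber b + star"
    if "i < a" "nimber i + nimber b + star \<le> 0" for a b i
    using that by (intro not_le_right_opt[OF _ that(2)])
      (unfold right_opts_plus_iff right_opts_nimber_iff, blast)
  have reply_snd: "\<not> 0 \<le> nimber a + nimber b + star"
    if "i < b" "nimber a + nimber i + star \<le> 0" for a b i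
    using that by (intro not_le_right_opt[OF _ that(2)])
      (unfold right_opts_plus_iff right_opts_nimber_iff, blast)
  have less': "?o k + ?e k + star \<le> 0" if "k < j" for k
    using less[OF that] by (simp add: add.commute)
  have fst: "\<not> 0 \<le> nimber i + ?o j + star" if "i < 2 * j" for i
  proof -
    from parity[OF that] obtain k where "k < j" "i = 2 * k \<or> i = Suc (2 * k)" by blast
    then show ?thesis
      using less less' reply_snd[where a = "2 * k" and b = "Suc (2 * j)" and i = "Suc (2 * k)"]
        reply_snd[where a = "Suc (2 * k)" and b = "Suc (2 * j)" and i = "2 * k"] by auto
  qed
  have snd: "\<not> 0 \<le> ?e j + nimber i + star" if "i < 2 * j" for i
  proof -
    from parity[OF that] obtain k where "k < j" "i = 2 * k \<or> i = Suc (2 * k)" by blast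
    then show ?thesis
      using less less' reply_fst[where a = "2 * j" and b = "2 * k" and i = "Suc (2 * k)"]
        reply_fst[where a = "2 * j" and b = "Suc (2 * k)" and i = "2 * k"] by auto
  qed
  have snd': "\<not> 0 \<le> ?e j + ?e j + star"
    using not_zero_le_add_nimberI[of 0 1 "?e j + ?e j"] nimber_add_self by simp
  have star: "\<not> 0 \<le> ?e j + ?o j"
    using not_zero_le_add_nimberI[of "2 * j" "Suc (2 * j)" "?e j"] nimber_add_self by simp
  show ?case
    unfolding le_zero_iff
  proof
    fix x assume "x |\<in>| left_opts (?e j + ?o j + star)"
    then consider i where "i < 2 * j" "x = nimber i + ?o j + star"
      | i where "i < Suc (2 * j)" "x = ?e j + nimber i + star" | "x = ?e j + ?o j"
      unfolding left_opts_plus_iff left_opts_nimber_iff by auto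
    then show "\<not> 0 \<le> x"
      using fst snd snd' star by cases (auto simp: less_Suc_eq)
  qed
qed

text \<open>The only nontrivial nim addition needed: adding the star flips the last binary digit of
  the heap size.\<close>

lemma nimber_add_star: "nimber m + star \<approx> nimber (if even m then Suc m else m - 1)"
proof -
  \<comment> \<open>The reverse inequality comes by negation, as every heap is its own
    negative.\<close>
  have zero: "nimber (2 * j) + nimber (Suc (2 * j)) + star \<approx> 0" for j
    using nimber_double_add_star_le[of j]
      uminus_le_uminus_game[of "nimber (2 * j) + nimber (Suc (2 * j)) + star" 0]
    by (simp add: game_eq_def)
  have 1: "nimber (2 * j) + star \<approx> nimber (Suc (2 * j))" for j
  proof -
    let ?o = "nimber (Suc (2 * j))"
    have "nimber (2 * j) + star + 0 \<approx> nimber (2 * j) + star + (?o + ?o)"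
      by (intro game_eq_add game_eq_sym[OF nimber_add_self_eq]) simp_all
    also have "\<dots> = (nimber (2 * j) + ?o + star) + ?o" by (simp only: ac_simps)
    also have "\<dots> \<approx> 0 + ?o" by (intro game_eq_add zero) simp
    finally show ?thesis by simp
  qed
  have 2: "nimber (Suc (2 * j)) + star \<approx> nimber (2 * j)" for j
  proof -
    have "nimber (Suc (2 * j)) + star \<approx> (nimber (2 * j) + star) + star"
      using 1 by (intro game_eq_add) (auto intro: game_eq_sym)
    also have "\<dots> \<approx> nimber (2 * j) + 0"
      unfolding add.assoc by (intro game_eq_add nimber_add_self_eq) simp
    finally show ?thesis by simp
  qed
  show ?thesis
    using 1[of "m div 2"] 2[of "m div 2"] by (cases "even m") (auto elim!: oddE)
qed

section \<open>Copies of down, and paths with at most four vertices\<close>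

abbreviation downs :: "nat \<Rightarrow> game" where
  "downs v \<equiv> ((+) down ^^ v) 0"

lemma downs_le_zero: "downs v \<le> 0"
proof (induction v)
  case (Suc v)
  then show ?case using add_mono_game[OF down_le_zero Suc] by simp
qed simp

lemma left_opts_downs: "x |\<in>| left_opts (downs v) \<longleftrightarrow> (\<exists>u. v = Suc u \<and> x = star + downs u)"
proof (induction v arbitrary: x)
  case (Suc v)
  have "down + (star + downs u) = star + downs (Suc u)" for u by (simp add: ac_simps)
  then show ?case using Suc by (auto simp: left_opts_plus image_iff)
qed simp

lemma right_opts_downs: "x |\<in>| right_opts (downs v) \<longleftrightarrow> (\<exists>u. v = Suc u \<and> x = downs u)"
proof (induction v arbitrary: x)
  case (Suc v)
  then show ?case by (auto simp: right_opts_plus image_iff)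
qed simp

lemma path_position_small: "n < 4 \<Longrightarrow> path_position n = 0"
  by (rule game.expand) (auto simp: left_opts_path_position right_opts_path_position intro!: fset_eqI)

text \<open>Left can only delete an end, leaving three vertices, and Right can only cut in the
  middle; all these remainders are dead.\<close>

lemma path_position_4: "path_position 4 = star"
proof -
  have "x |\<in>| left_opts (path_position 4) \<longleftrightarrow> x = 0" for x
  proof
    assume "x |\<in>| left_opts (path_position 4)"
    then show "x = 0" by (auto simp: left_opts_path_position path_position_small)
  next
    assume "x = 0"
    then show "x |\<in>| left_opts (path_position 4)"
      unfolding left_opts_path_position
      by (intro exI[of _ 0] exI[of _ 3]) (simp add: path_position_small)
  qed
  moreover have "x |\<in>| right_opts (path_position 4) \<longleftrightarrow> x = 0" for x
  proof
    assume "x |\<in>| right_opts (path_position 4)"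
    then show "x = 0" by (auto simp: right_opts_path_position path_position_small)
  next
    assume "x = 0"
    then show "x |\<in>| right_opts (path_position 4)"
      unfolding right_opts_path_position
      by (intro exI[of _ 2]) (simp add: path_position_small)
  qed
  ultimately show ?thesis
    by (intro game.expand) (auto simp: star_def intro!: fset_eqI)
qed

section \<open>Sums of paths\<close>

definition forest :: "nat multiset \<Rightarrow> game" where
  "forest S = (\<Sum>n\<in>#S. path_position n)"

text \<open>Subtraction on naturals makes the summand for \<open>n = 0\<close> zero, as it should be
  for the empty pieces that Left's end deletions create.\<close>

definition weight :: "nat multiset \<Rightarrow> nat" where
  "weight S = (\<Sum>n\<in>#S. (n - 1) div 4)"

lemma forest_simps [simp]:
  "forest {#} = 0" "forest (add_mset n S) = path_position n + forest S"
  by (simp_all add: forest_def)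

lemma weight_simps [simp]:
  "weight {#} = 0" "weight (add_mset n S) = (n - 1) div 4 + weight S"
  by (simp_all add: weight_def)

text \<open>Stated for an abstract option function so that one induction serves both
  \<open>left_opts\<close> and \<open>right_opts\<close>.\<close>

lemma opts_forest:
  assumes zero: "opts 0 = {||}"
    and plus: "\<And>G H x. x |\<in>| opts (G + H) \<longleftrightarrow>
      (\<exists>y. y |\<in>| opts G \<and> x = y + H) \<or> (\<exists>y. y |\<in>| opts H \<and> x = G + y)"
  shows "x |\<in>| opts (forest S) \<longleftrightarrow>
    (\<exists>n T y. S = add_mset n T \<and> y |\<in>| opts (path_position n) \<and> x = y + forest T)"
proof (induction S arbitrary: x)
  case (add n S)
  have "x |\<in>| opts (forest (add_mset n S)) \<longleftrightarrow>
    (\<exists>y. y |\<in>| opts (path_position n) \<and> x = y + forest S) \<or>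
    (\<exists>k T y. S = add_mset k T \<and> y |\<in>| opts (path_position k) \<and> x = path_position n + (y + forest T))"
    unfolding forest_simps plus add by blast
  also have "\<dots> \<longleftrightarrow> (\<exists>k T y. add_mset n S = add_mset k T \<and> y |\<in>| opts (path_position k) \<and> x = y + forest T)"
    (is "?l \<longleftrightarrow> ?r")
  proof
    assume ?r
    then obtain k T y where *: "add_mset n S = add_mset k T"
      "y |\<in>| opts (path_position k)" "x = y + forest T" by blast
    from *(1) consider "n = k" "S = T" | K where "S = add_mset k K" "T = add_mset n K"
      unfolding add_eq_conv_ex by blast
    then show ?l
    proof cases
      case 2
      with * show ?l by (intro disjI2 exI[of _ k] exI[of _ K] exI[of _ y]) (simp add: ac_simps)
    qed (use * in blast)
  next
    assume ?l
    then show ?r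
    proof
      assume "\<exists>k T y. S = add_mset k T \<and> y |\<in>| opts (path_position k) \<and> x = path_position n + (y + forest T)"
      then obtain k T y where "S = add_mset k T" "y |\<in>| opts (path_position k)"
        "x = path_position n + (y + forest T)" by blast
      then show ?r
        by (intro exI[of _ k] exI[of _ "add_mset n T"] exI[of _ y]) (simp add: ac_simps add_mset_commute)
    qed blast
  qed
  finally show ?case .
qed (simp add: zero)

lemma left_opts_forest:
  "x |\<in>| left_opts (forest S) \<longleftrightarrow> (\<exists>a b T. S = add_mset (a + b + 1) T \<and> 4 \<le> a + b + 1 \<and>
    a \<noteq> 1 \<and> b \<noteq> 1 \<and> x = forest (add_mset a (add_mset b T)))"
  unfolding opts_forest[of left_opts, OF left_opts_zero left_opts_plus_iff] left_opts_path_position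
  by (fastforce simp: add.assoc)

lemma right_opts_forest:
  "x |\<in>| right_opts (forest S) \<longleftrightarrow> (\<exists>a b T. S = add_mset (a + b) T \<and> 2 \<le> a \<and> 2 \<le> b \<and>
    x = forest (add_mset a (add_mset b T)))"
  unfolding opts_forest[of right_opts, OF right_opts_zero right_opts_plus_iff] right_opts_path_position
  by (fastforce simp: add.assoc)

section \<open>Sums of paths, copies of down and one nim heap\<close>

definition pos :: "nat multiset \<Rightarrow> nat \<Rightarrow> nat \<Rightarrow> game" where
  "pos S v m = forest S + downs v + nimber m"

lemma left_opts_pos:
  "x |\<in>| left_opts (pos S v m) \<longleftrightarrow>
    (\<exists>a b T. S = add_mset (a + b + 1) T \<and> 4 \<le> a + b + 1 \<and> a \<noteq> 1 \<and> b \<noteq> 1 \<and>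
      x = pos (add_mset a (add_mset b T)) v m) \<or>
    (\<exists>u. v = Suc u \<and> x = pos (add_mset 4 S) u m) \<or> (\<exists>j<m. x = pos S v j)"
proof -
  have "x |\<in>| left_opts (pos S v m) \<longleftrightarrow>
    (\<exists>y. y |\<in>| left_opts (forest S) \<and> x = y + downs v + nimber m) \<or>
    (\<exists>y. y |\<in>| left_opts (downs v) \<and> x = forest S + y + nimber m) \<or>
    (\<exists>j<m. x = pos S v j)"
    unfolding pos_def left_opts_plus_iff left_opts_nimber_iff by blast
  also have "(\<exists>y. y |\<in>| left_opts (downs v) \<and> x = forest S + y + nimber m) \<longleftrightarrow>
    (\<exists>u. v = Suc u \<and> x = pos (add_mset 4 S) u m)"
  proof -
    have "forest S + (star + downs u) + nimber m = pos (add_mset 4 S) u m" for u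
      by (simp add: pos_def path_position_4 ac_simps)
    then show ?thesis unfolding left_opts_downs by (auto simp del: funpow.simps)
  qed
  finally show ?thesis unfolding left_opts_forest pos_def by blast
qed

lemma right_opts_pos:
  "x |\<in>| right_opts (pos S v m) \<longleftrightarrow>
    (\<exists>a b T. S = add_mset (a + b) T \<and> 2 \<le> a \<and> 2 \<le> b \<and> x = pos (add_mset a (add_mset b T)) v m) \<or>
    (\<exists>u. v = Suc u \<and> x = pos S u m) \<or> (\<exists>j<m. x = pos S v j)"
proof -
  have "x |\<in>| right_opts (pos S v m) \<longleftrightarrow>
    (\<exists>y. y |\<in>| right_opts (forest S) \<and> x = y + downs v + nimber m) \<or>
    (\<exists>y. y |\<in>| right_opts (downs v) \<and> x = forest S + y + nimber m) \<or>
    (\<exists>j<m. x = pos S v j)"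
    unfolding pos_def right_opts_plus_iff right_opts_nimber_iff by blast
  then show ?thesis unfolding right_opts_forest right_opts_downs pos_def by blast
qed

text \<open>Floors are superadditive, and the two pieces have fewer than \<open>a + b\<close>
  vertices to count once each length is reduced by one.\<close>

lemma weight_left_move:
  "weight (add_mset a (add_mset b T)) \<le> weight (add_mset (a + b + 1) T)"
  by simp

text \<open>Writing \<open>a - 1 = 4 * p + r\<close> and \<open>b - 1 = 4 * q + s\<close> with
  \<open>r, s \<le> 3\<close>, the whole path contributes the quotient of
  \<open>4 * (p + q) + r + s + 1\<close> by 4, and \<open>r + s + 1 \<le> 7\<close>. The case of an
  empty piece is immediate.\<close>

lemma weight_right_move:
  "weight (add_mset (a + b) T) \<le> Suc (weight (add_mset a (add_mset b T)))"
  by simp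

text \<open>All paths have at most four vertices, so each is 0 or a star, and the parity of the
  number of stars decides.\<close>

lemma weight_zero_forest: "weight S = 0 \<Longrightarrow> \<exists>c\<le>1. forest S \<approx> nimber c"
proof (induction S)
  case (add n S)
  then obtain c where c: "c \<le> 1" "forest S \<approx> nimber c" by auto
  show ?case
  proof (cases "n = 4")
    case True
    have "path_position 4 + forest S \<approx> nimber c + star"
      using game_eq_add[OF c(2) game_eq_refl[of star]] by (simp add: path_position_4 add.commute)
    also note nimber_add_star
    finally show ?thesis using True c(1) by (auto intro!: exI[of _ "1 - c"] simp: le_Suc_eq)
  next
    case False
    with add.prems have "n < 4" by auto
    with c show ?thesis by (auto simp: path_position_small)
  qed
qed (auto intro!: exI[of _ 0])

lemma forest_add_nimber:
  assumes "weight S = 0"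
  obtains k where "forest S + nimber m \<approx> nimber k"
proof -
  obtain c where c: "c \<le> 1" "forest S \<approx> nimber c" using weight_zero_forest[OF assms] by blast
  have eq: "forest S + nimber m \<approx> nimber m + nimber c"
    using game_eq_add[OF c(2) game_eq_refl[of "nimber m"]] by (simp add: add.commute)
  consider "c = 0" | "c = 1" using c(1) by linarith
  then show thesis
  proof cases
    case 1
    then show ?thesis using that eq by simp
  next
    case 2
    then show ?thesis using that game_eq_trans[OF eq] nimber_add_star by blast
  qed
qed

lemma weight_pos_obtain:
  assumes "0 < weight S"
  obtains n T where "S = add_mset n T" "5 \<le> n"
proof -
  have "\<exists>n. n \<in># S \<and> 5 \<le> n"
    using assms
  proof (induction S)
    case (add n S)
    then show ?case by (cases "5 \<le> n") auto
  qed simp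
  then show thesis using that by (metis insert_DiffM)
qed

section \<open>Single paths with five to eight vertices beside a heap\<close>

lemma not_le_zero_path_moveI:
  assumes "n = a + b + 1" "4 \<le> n" "a \<noteq> 1" "b \<noteq> 1" "0 \<le> path_position a + path_position b + G"
  shows "\<not> path_position n + G \<le> 0"
proof (rule not_le_left_opt[OF _ assms(5)])
  have "path_position a + path_position b |\<in>| left_opts (path_position n)"
    using assms by (auto simp: left_opts_path_position)
  then show "path_position a + path_position b + G |\<in>| left_opts (path_position n + G)"
    by (auto simp: left_opts_plus)
qed

text \<open>Left's options of this path are 0 and star, Right's only option is 0. Moving first, Left
  goes to 0 beside no heap, to the star beside a star, and otherwise lowers the heap to 1. Moving
  second beside a nonempty heap, she takes the heap once Right has broken the path.\<close>

lemma path_5_not_le_zero: "\<not> path_position 5 + nimber m \<le> 0"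
  and zero_le_path_5: "0 < m \<Longrightarrow> 0 \<le> path_position 5 + nimber m"
proof -
  have opts: "y = 0" if "y |\<in>| right_opts (path_position 5)" for y
  proof -
    from that obtain a b
      where "(5::nat) = a + b" "2 \<le> a" "2 \<le> b" "y = path_position a + path_position b"
      unfolding right_opts_path_position by blast
    then show ?thesis by (simp add: path_position_small)
  qed
  have 0: "\<not> path_position 5 + nimber 0 \<le> 0"
    by (rule not_le_zero_path_moveI[of _ 2 2]) (simp_all add: path_position_small)
  have 1: "0 \<le> path_position 5 + nimber 1"
    by (rule zero_le_add_nimberI) (use 0 in \<open>auto dest!: opts simp: nimber_not_le_zero\<close>)
  have not_le: "\<not> path_position 5 + nimber m \<le> 0" for m
  proof -
    consider "m = 0" | "m = 1" | "1 < m" by linarith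
    then show ?thesis
    proof cases
      case 2
      show ?thesis unfolding 2
        by (rule not_le_zero_path_moveI[of _ 4 0])
          (simp_all add: path_position_small path_position_4 nimber_add_self del: One_nat_def)
    qed (use 0 1 not_le_zero_add_nimberI in auto)
  qed
  then show "\<not> path_position 5 + nimber m \<le> 0" .
  show "0 \<le> path_position 5 + nimber m" if "0 < m"
    by (rule zero_le_add_nimberI) (use not_le that in \<open>auto dest!: opts simp: nimber_not_le_zero\<close>)
qed

text \<open>Beside a heap Left deletes an end vertex and reaches \<open>zero_le_path_5\<close>;
  without one she splits into two dead paths.\<close>

lemma path_6_not_le_zero: "\<not> path_position 6 + nimber m \<le> 0"
proof (cases "m = 0")
  case True
  then show ?thesis
    by (intro not_le_zero_path_moveI[of _ 2 3]) (simp_all add: path_position_small)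
next
  case False
  then show ?thesis
    by (intro not_le_zero_path_moveI[of _ 5 0]) (simp_all add: path_position_small zero_le_path_5)
qed

text \<open>Right can reach 0 or a star. Against the star Left lowers the heap to 1, which is why
  the heap must exceed 1.\<close>

lemma zero_le_path_6: "1 < m \<Longrightarrow> 0 \<le> path_position 6 + nimber m"
proof (rule zero_le_add_nimberI)
  fix y assume "1 < m" "y |\<in>| right_opts (path_position 6)"
  then obtain a b where ab: "(6::nat) = a + b" "2 \<le> a" "2 \<le> b" "y = path_position a + path_position b"
    by (auto simp: right_opts_path_position)
  then have "a = 2 \<and> b = 4 \<or> a = 3 \<and> b = 3 \<or> a = 4 \<and> b = 2" by linarith
  then have "y = 0 \<or> y = star" using ab by (auto simp: path_position_small path_position_4)
  then show "\<not> y + nimber m \<le> 0"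
    using nimber_not_le_zero[of m] not_le_zero_add_nimberI[of 1 m star] nimber_add_self[of 1] \<open>1 < m\<close>
    by auto
qed (rule path_6_not_le_zero)

text \<open>Left splits into two dead paths beside no heap, leaves a star to cancel a heap of size
  1, and shortens to six vertices beside a larger heap.\<close>

lemma path_7_not_le_zero: "\<not> path_position 7 + nimber m \<le> 0"
proof -
  consider "m = 0" | "m = 1" | "1 < m" by linarith
  then show ?thesis
  proof cases
    case 1
    then show ?thesis
      by (intro not_le_zero_path_moveI[of _ 3 3]) (simp_all add: path_position_small)
  next
    case 2
    show ?thesis unfolding 2
      by (rule not_le_zero_path_moveI[of _ 2 4])
        (simp_all add: path_position_small path_position_4 nimber_add_self del: One_nat_def)
  next
    case 3
    then show ?thesis
      by (intro not_le_zero_path_moveI[of _ 6 0]) (simp_all add: path_position_small zero_le_path_6)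
  qed
qed

lemma zero_le_path_7: "0 \<le> path_position 7"
  unfolding zero_le_iff
proof
  fix y assume "y |\<in>| right_opts (path_position 7)"
  then obtain a b where ab: "(7::nat) = a + b" "2 \<le> a" "2 \<le> b" "y = path_position a + path_position b"
    by (auto simp: right_opts_path_position)
  then have "a = 2 \<and> b = 5 \<or> a = 3 \<and> b = 4 \<or> a = 4 \<and> b = 3 \<or> a = 5 \<and> b = 2" by linarith
  then have "y = path_position 5 \<or> y = star"
    using ab by (auto simp: path_position_small path_position_4)
  then show "\<not> y \<le> 0"
    using path_5_not_le_zero[of 0] nimber_not_le_zero[of 1] by auto
qed

text \<open>Without a heap Left shortens to seven vertices, where she wins moving second; with a
  heap she leaves the path on five.\<close>

lemma path_8_not_le_zero: "\<not> path_position 8 + nimber m \<le> 0"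
proof (cases "m = 0")
  case True
  then show ?thesis
    by (intro not_le_zero_path_moveI[of _ 7 0]) (simp_all add: path_position_small zero_le_path_7)
next
  case False
  then show ?thesis
    by (intro not_le_zero_path_moveI[of _ 2 5]) (simp_all add: path_position_small zero_le_path_5)
qed

text \<open>Here Left has no unit to spare. The weight sits in a single path of five to eight
  vertices, and all other paths merge with the heap into one heap, so the four preceding cases
  suffice.\<close>

lemma weight_1_not_le_zero:
  assumes "weight S = 1"
  shows "\<not> forest S + nimber m \<le> 0"
proof -
  obtain n T where S: "S = add_mset n T" "5 \<le> n"
    using weight_pos_obtain[of S] assms by auto
  with assms have T: "weight T = 0" and "n < 9" by auto
  then have n: "n = 5 \<or> n = 6 \<or> n = 7 \<or> n = 8" using S(2) by linarith
  obtain k where k: "forest T + nimber m \<approx> nimber k" using forest_add_nimber[OF T] .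
  have "forest S + nimber m \<approx> path_position n + nimber k"
    using game_eq_add[OF game_eq_refl k] S by (simp add: add.assoc)
  then have "forest S + nimber m \<le> 0 \<longleftrightarrow> path_position n + nimber k \<le> 0"
    by (rule game_eq_le_cong) simp
  then show ?thesis
    using n path_5_not_le_zero path_6_not_le_zero path_7_not_le_zero path_8_not_le_zero by auto
qed

lemma forest_small: "(\<And>n. n \<in># S \<Longrightarrow> n < 4) \<Longrightarrow> forest S = 0"
  by (induction S) (auto simp: path_position_small)

text \<open>These are the sums of weight two in which deleting an end vertex of any live path costs
  a unit. Apart from dead paths such a sum is one path on nine vertices or two on five.\<close>

lemma all_one_mod_4_not_le_zero:
  assumes "weight S = 2" "\<And>n. n \<in># S \<Longrightarrow> n < 4 \<or> n mod 4 = 1"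
  shows "\<not> forest S \<le> 0"
proof -
  \<comment> \<open>Length 4 is excluded by the congruence, so paths of weight zero are dead and
    contribute no star.\<close>
  have small: "forest T = 0" if "weight T = 0" "T \<subseteq># S" for T
  proof (rule forest_small)
    fix n assume "n \<in># T"
    then have "n < 4 \<or> n mod 4 = 1" "(n - 1) div 4 = 0"
      using assms(2)[of n] that by (auto simp: weight_def dest: mset_subset_eqD)
    then show "n < 4" by presburger
  qed
  obtain n T where S: "S = add_mset n T" "5 \<le> n"
    using weight_pos_obtain[of S] assms(1) by auto
  then have "n mod 4 = 1" using assms(2)[of n] by auto
  moreover have "(n - 1) div 4 \<le> 2" using assms(1) S by simp
  ultimately have "n = 5 \<or> n = 9" using S(2) by presburger
  then show ?thesis
  proof
    assume n: "n = 9"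
    then have "forest T = 0" using small[of T] assms(1) S by simp
    \<comment> \<open>Left deletes the middle vertex, leaving two stars that cancel.\<close>
    moreover have "\<not> path_position 9 + 0 \<le> 0"
      by (rule not_le_zero_path_moveI[of _ 4 4])
        (simp_all add: path_position_4 nimber_add_self del: One_nat_def)
    ultimately show ?thesis using S n by simp
  next
    assume n: "n = 5"
    then obtain n' U where T: "T = add_mset n' U" "5 \<le> n'"
      using weight_pos_obtain[of T] assms(1) S by auto
    then have "n' mod 4 = 1" using assms(2)[of n'] S by auto
    moreover have "(n' - 1) div 4 \<le> 1" using assms(1) S n T by simp
    ultimately have n': "n' = 5" using T(2) by presburger
    then have "forest U = 0" using small[of U] assms(1) S T n by simp
    \<comment> \<open>Left turns one path into a star and then wins moving second by
      \<open>zero_le_path_5\<close>.\<close>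
    moreover have "\<not> path_position 5 + path_position 5 \<le> 0"
      by (rule not_le_zero_path_moveI[of _ 4 0])
        (use zero_le_path_5[of 1] in \<open>simp_all add: path_position_4 path_position_small add.commute del: One_nat_def\<close>)
    ultimately show ?thesis using S T n n' by simp
  qed
qed

section \<open>Winning strategies according to the difference of weight and copies of down\<close>

lemma weight_gt_pos:
  shows "v < weight S \<Longrightarrow> \<not> pos S v m \<le> 0"
    and "Suc v < weight S \<Longrightarrow> 0 \<le> pos S v m"
\<comment> \<open>Simultaneous induction: a first move by Left leads to the second claim for an
  option, and a first move by Right leads to the first claim.\<close>
proof (induction "size (pos S v m)" arbitrary: S v m rule: less_induct)
  case less
  {
    case 1
    have left: "\<not> pos S v m \<le> 0"
      if "pos T u j |\<in>| left_opts (pos S v m)" "Suc u < weight T" for T u j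
      using less(2)[of T u j] that not_le_left_opt by simp
    show ?case
    proof (cases v)
      case (Suc u)
      \<comment> \<open>Left plays in a copy of down; the new path has weight zero, so the margin
        grows from one to two.\<close>
      have "pos (add_mset 4 S) u m |\<in>| left_opts (pos S v m)"
        using Suc unfolding left_opts_pos by blast
      then show ?thesis using left 1 Suc by simp
    next
      case v: 0
      show ?thesis
      proof (cases "weight S = 1")
        case True
        then show ?thesis using weight_1_not_le_zero v by (simp add: pos_def)
      next
        case False
        with 1 have W: "2 \<le> weight S" by simp
        show ?thesis
        proof (cases "m = 0")
          case False
          \<comment> \<open>Removing the heap is a waiting move that keeps the margin of at least
            two.\<close>
          then have "pos S v 0 |\<in>| left_opts (pos S v m)" unfolding left_opts_pos by auto
          then show ?thesis using left W v by simp
        next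
          case m: True
          have shorten: "pos (add_mset (n - 1) (add_mset 0 T)) v m |\<in>| left_opts (pos S v m)"
            if "S = add_mset n T" "4 \<le> n" for n T
            using that unfolding left_opts_pos
            by (intro disjI1 exI[of _ "n - 1"] exI[of _ 0] exI[of _ T]) auto
          \<comment> \<open>Either some end deletion costs no weight, or a unit can be spared, or
            the sum is one of those settled separately.\<close>
          consider n where "n \<in># S" "4 \<le> n" "n mod 4 \<noteq> 1" | "3 \<le> weight S"
            | "weight S = 2" "\<And>n. n \<in># S \<Longrightarrow> n < 4 \<or> n mod 4 = 1"
          proof (cases "weight S = 2")
            case False
            with W have "3 \<le> weight S" by simp
            then show thesis by (rule that(2))
          next
            case True
            then show thesis using that(1,3) not_le by blast
          qed
          then show ?thesis
          proof cases
            case 1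
            then obtain T where S: "S = add_mset n T" by (metis insert_DiffM)
            have "n = Suc (Suc (n - 2))" using 1(2) by simp
            then obtain k where k: "n = Suc (Suc k)" by blast
            then have "Suc k mod 4 \<noteq> 0" using 1(3) by (auto simp: mod_Suc)
            then have "(n - 1 - 1) div 4 = (n - 1) div 4" using k by (simp add: div_Suc)
            then have "weight (add_mset (n - 1) (add_mset 0 T)) = weight S" using S by simp
            then show ?thesis using left[OF shorten[OF S 1(2)]] W v by simp
          next
            case 2
            then obtain n T where S: "S = add_mset n T" "5 \<le> n"
              using weight_pos_obtain[of S] by auto
            have "(n - 1) div 4 \<le> Suc ((n - 1 - 1) div 4)" by presburger
            then have "weight S \<le> Suc (weight (add_mset (n - 1) (add_mset 0 T)))" using S by simp
            then show ?thesis using left[OF shorten[OF S(1)]] S(2) 2 v by simp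
          next
            case 3
            then show ?thesis using all_one_mod_4_not_le_zero v m by (simp add: pos_def)
          qed
        qed
      qed
    qed
  next
    case 2
    show ?case unfolding zero_le_iff
    proof
      fix y assume y: "y |\<in>| right_opts (pos S v m)"
      \<comment> \<open>Each move by Right lowers the difference of weight and copies of down by at
        most one; deleting a copy of down even raises it.\<close>
      then obtain T u j where T: "y = pos T u j" "weight S + u \<le> Suc (weight T + v)"
        "weight S \<le> Suc (weight T)" "u \<le> v"
        unfolding right_opts_pos using weight_right_move by (fastforce simp del: weight_simps)
      then have "u < weight T" using 2 by simp
      then show "\<not> y \<le> 0" using less(1)[of T u j] T(1) y by simp
    qed
  }
qed

text \<open>Only a split of a path can use up the margin of one. Left then regains the unit from a
  copy of down, if any is left; otherwise she still has positive weight, or the paths are worth at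
  most a star and the heap decides.\<close>

lemma weight_gt_pos_far:
  "v < weight S \<Longrightarrow> 1 < m \<Longrightarrow> 0 \<le> pos S v m"
proof (induction "size (pos S v m)" arbitrary: S v rule: less_induct)
  case less
  show ?case unfolding zero_le_iff
  proof
    fix y assume y: "y |\<in>| right_opts (pos S v m)"
    then consider a b T where "S = add_mset (a + b) T" "y = pos (add_mset a (add_mset b T)) v m"
      | u where "v = Suc u" "y = pos S u m" | j where "y = pos S v j"
      unfolding right_opts_pos by blast
    then show "\<not> y \<le> 0"
    proof cases
      case 1
      define U where "U = add_mset a (add_mset b T)"
      have U: "y = pos U v m" "v \<le> weight U"
        using 1 less.prems weight_right_move[of a b T] by (simp_all add: U_def)
      show ?thesis
      proof (cases v)
        case (Suc u)
        have opt: "pos (add_mset 4 U) u m |\<in>| left_opts y"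
          unfolding U(1) left_opts_pos using Suc by blast
        moreover have "size (pos (add_mset 4 U) u m) < size (pos S v m)"
          using opt y by (meson order.strict_trans size_option)
        then have "0 \<le> pos (add_mset 4 U) u m"
          using less U Suc by simp
        ultimately show ?thesis by (rule not_le_left_opt)
      next
        case 0
        show ?thesis
        proof (cases "weight U = 0")
          case True
          \<comment> \<open>Left lowers the heap to \<open>c\<close>, cancelling the paths; this is
            a legal move because \<open>c \<le> 1 < m\<close>.\<close>
          then obtain c where c: "c \<le> 1" "forest U \<approx> nimber c" using weight_zero_forest by blast
          have "0 \<le> nimber c + nimber c" by (rule nimber_add_self)
          then have "0 \<le> forest U + nimber c"
            using game_eq_le_cong[OF game_eq_refl game_eq_add[OF c(2) game_eq_refl]] by blast
          then show ?thesis
            using U 0 c(1) less.prems not_le_zero_add_nimberI[of c m "forest U"] by (simp add: pos_def)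
        next
          case False
          then show ?thesis using U 0 weight_gt_pos(1) by simp
        qed
      qed
    next
      case 2
      then show ?thesis using less.prems weight_gt_pos(1) by simp
    next
      case 3
      then show ?thesis using less.prems weight_gt_pos(1) by simp
    qed
  qed
qed

text \<open>Right cuts four vertices off a path of positive weight. From five vertices that would
  isolate one, so there he cuts off three. The choice depends neither on the copies of down nor on
  the heap.\<close>

lemma decrease_weight:
  assumes "0 < weight S"
  obtains T where "Suc (weight T) = weight S" "\<And>v m. pos T v m |\<in>| right_opts (pos S v m)"
proof -
  obtain n T where S: "S = add_mset n T" "5 \<le> n" using weight_pos_obtain[OF assms] .
  define a where "a = (if n = 5 then 3 else 4 :: nat)"
  have a: "n = a + (n - a)" "2 \<le> a" "2 \<le> n - a" using S(2) by (auto simp: a_def)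
  have "Suc ((n - a - 1) div 4) = (n - 1) div 4" "(a - 1) div 4 = 0"
    using S(2) by (auto simp: a_def div_if)
  then have "Suc (weight (add_mset a (add_mset (n - a) T))) = weight S" using S by simp
  moreover have "pos (add_mset a (add_mset (n - a) T)) v m |\<in>| right_opts (pos S v m)" for v m
    unfolding right_opts_pos using S(1) a
    by (intro disjI1 exI[of _ a] exI[of _ "n - a"] exI[of _ T]) simp
  ultimately show thesis by (rule that)
qed

text \<open>No exceptional small sums arise on this side: Right can lower the weight by exactly one
  as long as it is positive, and Left's moves gain her at most one unit.\<close>

lemma weight_lt_pos:
  shows "weight S < v \<Longrightarrow> \<not> 0 \<le> pos S v m"
    and "Suc (weight S) < v \<Longrightarrow> pos S v m \<le> 0"
proof (induction "size (pos S v m)" arbitrary: S v m rule: less_induct)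
  case less
  {
    case 1
    show ?case
    proof (cases "weight S = 0")
      case True
      \<comment> \<open>Paths and heap merge into one heap of size \<open>k\<close>. Right takes it
        or, if it is empty, turns a copy of down into 0; what remains is at most 0.\<close>
      then obtain k where k: "forest S + nimber m \<approx> nimber k" using forest_add_nimber by blast
      have "pos S v m \<approx> downs v + nimber k"
        using game_eq_add[OF game_eq_refl[of "downs v"] k] by (simp add: pos_def ac_simps)
      then have "0 \<le> pos S v m \<longleftrightarrow> 0 \<le> downs v + nimber k"
        by (intro game_eq_le_cong) simp_all
      moreover have "\<not> 0 \<le> downs v + nimber k"
      proof (cases "k = 0")
        case True
        obtain u where "v = Suc u" using 1 by (cases v) auto
        then have "downs u |\<in>| right_opts (downs v)" unfolding right_opts_downs by blast
        then show ?thesis using True not_le_right_opt[OF _ downs_le_zero] by simp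
      next
        case False
        then show ?thesis using not_zero_le_add_nimberI[of 0 k "downs v"] downs_le_zero by simp
      qed
      ultimately show ?thesis by blast
    next
      case False
      then obtain T where T: "Suc (weight T) = weight S" "pos T v m |\<in>| right_opts (pos S v m)"
        using decrease_weight by (metis neq0_conv)
      then have "pos T v m \<le> 0" using less(2)[of T v m] 1 by simp
      then show ?thesis by (rule not_le_right_opt[OF T(2)])
    qed
  next
    case 2
    show ?case unfolding le_zero_iff
    proof
      fix x assume x: "x |\<in>| left_opts (pos S v m)"
      then obtain T u j where T: "x = pos T u j" "weight T \<le> weight S" "v \<le> Suc u"
        unfolding left_opts_pos using weight_left_move by (fastforce simp del: weight_simps simp: weight_simps(2)[of 4])
      then have "weight T < u" using 2 by simp
      then show "\<not> 0 \<le> x" using less(1)[of T u j] T(1) x by simp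
    qed
  }
qed

text \<open>Only Left's move in a copy of down closes the gap. Right answers by lowering the weight;
  if it is zero and no copy of down is left, he lowers the heap to match the paths, which are worth
  0 or a star.\<close>

lemma weight_lt_pos_far:
  "weight S < v \<Longrightarrow> 1 < m \<Longrightarrow> pos S v m \<le> 0"
proof (induction "size (pos S v m)" arbitrary: S v rule: less_induct)
  case less
  show ?case unfolding le_zero_iff
  proof
    fix x assume x: "x |\<in>| left_opts (pos S v m)"
    then consider a b T where "S = add_mset (a + b + 1) T" "x = pos (add_mset a (add_mset b T)) v m"
      | u where "v = Suc u" "x = pos (add_mset 4 S) u m" | j where "x = pos S v j"
      unfolding left_opts_pos by blast
    then show "\<not> 0 \<le> x"
    proof cases
      case 1
      then show ?thesis
        using less.prems weight_left_move[of a b T] weight_lt_pos(1) by simp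
    next
      case 2
      define U where "U = add_mset 4 S"
      have U: "x = pos U u m" "weight U = weight S" "weight U \<le> u"
        using 2 less.prems by (simp_all add: U_def)
      show ?thesis
      proof (cases "weight U = 0")
        case False
        then obtain T where T: "Suc (weight T) = weight U" "pos T u m |\<in>| right_opts (pos U u m)"
          using decrease_weight by (metis neq0_conv)
        have "size (pos T u m) < size (pos S v m)"
          using T(2) U(1) x by (meson order.strict_trans size_option)
        then have "pos T u m \<le> 0" using less T(1) U by simp
        with T(2) U(1) show ?thesis using not_le_right_opt by blast
      next
        case W: True
        show ?thesis
        proof (cases "u = 0")
          case True
          from W obtain c where c: "c \<le> 1" "forest U \<approx> nimber c" using weight_zero_forest by blast
          have "nimber c + nimber c \<le> 0" by (rule nimber_add_self)
          then have "forest U + nimber c \<le> 0"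
            using game_eq_le_cong[OF game_eq_add[OF c(2) game_eq_refl] game_eq_refl] by blast
          then show ?thesis
            using U True c(1) less.prems not_zero_le_add_nimberI[of c m "forest U"] by (simp add: pos_def)
        next
          case False
          then show ?thesis using U W weight_lt_pos(1) by simp
        qed
      qed
    next
      case 3
      then show ?thesis using less.prems weight_lt_pos(1) by simp
    qed
  qed
qed

section \<open>Far star equivalence\<close>

text \<open>An equality of values only: for negative \<open>k\<close> the new copy of up has to
  cancel a copy of down.\<close>

lemma up_multiple_add_one: "up_multiple (k + 1) \<approx> up + up_multiple k"
proof (cases "0 \<le> k")
  case True
  then have "nat (k + 1) = Suc (nat k)" by simp
  with True show ?thesis by (simp add: up_multiple_def)
next
  case False
  then have eq: "up_multiple k = down + up_multiple (k + 1)"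
  proof -
    have "nat (- k) = Suc (nat (- (k + 1)))" using False by simp
    then show ?thesis using False by (cases "k = - 1") (simp_all add: up_multiple_def)
  qed
  have "0 + up_multiple (k + 1) \<approx> (up + down) + up_multiple (k + 1)"
    by (intro game_eq_add) (simp_all add: game_eq_def up_add_down)
  then show ?thesis by (simp add: eq add.assoc)
qed

lemma up_multiple_mono: "k \<le> l \<Longrightarrow> up_multiple k \<le> up_multiple l"
proof (induction l rule: int_ge_induct)
  case (step l)
  have "up_multiple l \<le> up + up_multiple l" using add_mono_game[OF zero_le_up order_refl] by simp
  also have "\<dots> \<le> up_multiple (l + 1)" using up_multiple_add_one by (simp add: game_eq_def)
  finally show ?case using step by (blast intro: order_trans)
qed simp

lemma add_uminus_le_iff: "G \<le> H - K \<longleftrightarrow> G + K \<le> H" "H - K \<le> G \<longleftrightarrow> H \<le> G + K"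
  for G H K :: game
proof -
  have "(H - K) + K \<approx> H"
    using game_eq_add[OF game_eq_refl[of H], of "K + - K" 0]
    by (simp add: game_eq_def minus_game_def ac_simps)
  then show "G \<le> H - K \<longleftrightarrow> G + K \<le> H" "H - K \<le> G \<longleftrightarrow> H \<le> G + K"
    using add_le_cancel_right_game[of G K "H - K"] add_le_cancel_right_game[of "H - K" K G]
      game_eq_le_cong[of "H - K + K" H "G + K" "G + K"] game_eq_le_cong[of "G + K" "G + K" "H - K + K" H]
    by simp_all
qed

text \<open>Used in both directions, this makes the multiple unique, so that the definite
  description in \<open>atomic_weight\<close> denotes it.\<close>

lemma far_star_equiv_up_multiple_le:
  assumes "far_star_equiv G (up_multiple k)" "far_star_equiv G (up_multiple l)"
  shows "l \<le> k"
proof (rule ccontr)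
  assume "\<not> l \<le> k"
  then have "up_multiple (k + 1) \<le> up_multiple l" by (intro up_multiple_mono) simp
  then have kl: "up + up_multiple k \<le> up_multiple l"
    using up_multiple_add_one[of k] by (auto simp: game_eq_def intro: order_trans)
  obtain M N where
    M: "\<And>n. n \<ge> M \<Longrightarrow> G \<le> up + nimber n + up_multiple k" and
    N: "\<And>n. n \<ge> N \<Longrightarrow> down + nimber n + up_multiple l \<le> G"
    using assms unfolding far_star_equiv_def less_game_def add_uminus_le_iff by metis
  define j where "j = M + N"
  \<comment> \<open>The lower bound is read at heap \<open>2 * j\<close> and the upper bound at heap
    \<open>2 * j + 1\<close>. Equal heaps would cancel and leave only \<open>down \<le> 0\<close>,
    which is true; these two differ by a star.\<close>
  define e o' where "e = nimber (2 * j)" and "o' = nimber (Suc (2 * j))"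
  have "down + e + (up + up_multiple k) \<le> down + e + up_multiple l" using kl by simp
  also have "\<dots> \<le> G" using N by (simp add: e_def j_def)
  also have "G \<le> up + o' + up_multiple k" using M by (simp add: o'_def j_def)
  finally have "(down + e) + (up + up_multiple k) \<le> o' + (up + up_multiple k)"
    by (simp add: ac_simps)
  then have "down + e \<le> o'" by simp
  then have "(down + e) + (up + e) \<le> o' + (up + e)" by simp
  moreover have "(down + e) + (up + e) \<approx> 0"
    using game_eq_add[of "up + down" 0 "e + e" 0] nimber_add_self_eq up_add_down
    by (simp add: game_eq_def e_def ac_simps)
  moreover have "o' + (up + e) \<approx> up + star"
  proof -
    have "o' + e \<approx> (e + star) + e"
      using nimber_add_star[of "2 * j"] by (intro game_eq_add) (auto simp: e_def o'_def intro: game_eq_sym)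
    also have "\<dots> \<approx> 0 + star"
      using game_eq_add[OF nimber_add_self_eq game_eq_refl, of "2 * j" star] by (simp add: e_def ac_simps)
    finally have "up + (o' + e) \<approx> up + star" by (intro game_eq_add) simp_all
    then show ?thesis by (simp add: ac_simps)
  qed
  ultimately have "0 \<le> up + star" using game_eq_le_cong by blast
  \<comment> \<open>Right moves up to star and wins, so \<open>0 \<le> up + star\<close>
    fails.\<close>
  moreover have "star + star |\<in>| right_opts (up + star)" by (auto simp: right_opts_plus)
  ultimately show False using not_le_right_opt nimber_add_self(1) by blast
qed

lemma up_multiple_of_nat: "- up_multiple (int w) = downs w"
  by (induction w) (simp_all add: up_multiple_def nat_add_distrib)

text \<open>Here \<open>Y\<close> is the difference of \<open>Z\<close> and \<open>H\<close>, so
  comparisons become questions about who wins \<open>Y\<close>.\<close>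

lemma le_iff_of_add_eq:
  assumes "Y + H \<approx> Z"
  shows "H \<le> Z \<longleftrightarrow> 0 \<le> Y" "Z \<le> H \<longleftrightarrow> Y \<le> 0"
  using add_le_cancel_right_game[where G = 0 and H = Y and K = H]
    add_le_cancel_right_game[where G = Y and H = 0 and K = H]
    game_eq_le_cong[OF game_eq_refl[of H] assms] game_eq_le_cong[OF assms game_eq_refl[of H]]
  by simp_all

lemma far_star_equiv_path:
  assumes "5 \<le> n"
  shows "far_star_equiv (path_position n) (up_multiple (int ((n - 1) div 4)))"
proof -
  define w where "w = (n - 1) div 4"
  have "0 < w" using assms by (simp add: w_def div_greater_zero_iff)
  \<comment> \<open>Subtracting down removes one of the \<open>w\<close> copies, leaving
    \<open>u\<close> of them and a margin of one for Left; this needs \<open>w\<close> positive,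
    hence at least five vertices.\<close>
  then obtain u where u: "w = Suc u" using gr0_implies_Suc by blast
  define Z where "Z = path_position n - up_multiple (int w)"
  have Z: "Z = path_position n + downs w" by (simp add: Z_def minus_game_def up_multiple_of_nat)
  have weight: "weight {#n#} = w" by (simp add: w_def)
  have "down + nimber m < Z \<and> Z < up + nimber m" if m: "2 \<le> m" for m
  proof
    have cancel: "nimber m + nimber m + G \<approx> G" for G
      using game_eq_add[OF nimber_add_self_eq game_eq_refl, of m G] by simp
    have "pos {#n#} u m + (down + nimber m) \<approx> Z"
      using cancel[of Z] by (simp add: pos_def Z u ac_simps)
    then have "down + nimber m \<le> Z \<longleftrightarrow> 0 \<le> pos {#n#} u m" "Z \<le> down + nimber m \<longleftrightarrow> pos {#n#} u m \<le> 0"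
      by (rule le_iff_of_add_eq)+
    then show "down + nimber m < Z"
      using weight_gt_pos_far[of u "{#n#}" m] weight_gt_pos(1)[of u "{#n#}" m] weight u m
      by (simp add: less_game_def)
    have "up + down + Z \<approx> Z"
      using game_eq_add[of "up + down" 0 Z Z] up_add_down by (simp add: game_eq_def)
    \<comment> \<open>Subtracting up adds a copy of down, so Right is ahead by one. As heaps are
      their own negatives, the heap stays in the difference.\<close>
    then have "pos {#n#} (Suc w) m + (up + nimber m) \<approx> Z"
      using cancel[of "up + down + Z"] game_eq_trans by (simp add: pos_def Z ac_simps)
    then have "Z \<le> up + nimber m \<longleftrightarrow> pos {#n#} (Suc w) m \<le> 0"
      "up + nimber m \<le> Z \<longleftrightarrow> 0 \<le> pos {#n#} (Suc w) m"
      by (rule le_iff_of_add_eq)+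
    then show "Z < up + nimber m"
      using weight_lt_pos_far[of "{#n#}" "Suc w" m] weight_lt_pos(1)[of "{#n#}" "Suc w" m] weight m
      by (simp add: less_game_def)
  qed
  then show ?thesis
    unfolding far_star_equiv_def Z_def w_def by blast
qed

theorem theorem3p17:
  fixes n :: nat
  assumes "n \<ge> 5"
  shows "(\<exists>!k. far_star_equiv (path_position n) (up_multiple k)) \<and>
         atomic_weight (path_position n) = \<lceil>real n / 4\<rceil> - 1"
proof -
  let ?k = "int ((n - 1) div 4)"
  have equiv: "far_star_equiv (path_position n) (up_multiple ?k)"
    using assms by (rule far_star_equiv_path)
  have unique: "k = ?k" if "far_star_equiv (path_position n) (up_multiple k)" for k
    using far_star_equiv_up_multiple_le equiv that by (intro antisym) blast+
  have "atomic_weight (path_position n) = ?k"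
    unfolding atomic_weight_def using equiv unique by (rule the_equality)
  moreover have "\<lceil>real n / 4\<rceil> = ?k + 1"
  proof -
    obtain q where q: "q = (n - 1) div 4" by blast
    have "4 * q + (n - 1) mod 4 = n - 1" unfolding q by (rule mult_div_mod_eq)
    moreover have "(n - 1) mod 4 < 4" by simp
    \<comment> \<open>The strict bound is on the left and the weak one on the right, which is why
      the floor of \<open>(n - 1) / 4\<close> is one less than the ceiling of
      \<open>n / 4\<close>.\<close>
    ultimately have "4 * q < n" "n \<le> 4 * q + 4" using assms by linarith+
    then have "real q < real n / 4" "real n / 4 \<le> real q + 1" by linarith+
    then have "\<lceil>real n / 4\<rceil> = int q + 1" by (intro ceiling_unique) simp_all
    then show ?thesis unfolding q .
  qed
  moreover have "\<exists>!k. far_star_equiv (path_position n) (up_multiple k)"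
    using equiv unique by (rule ex1I)
  ultimately show ?thesis by simp
qed

end
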